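(* Let $\mathcal{R}_H^0=\{f=h+\bar g\in\mathcal{H}:\operatorname{Re}h'(z)>|g'(z)|\text{ for all }z\in\mathbb{D}\}$. Then $\mathcal{R}_H^0$ is the harmonic analogue of $\mathcal{R}$; in particular $\mathcal{R}_H^0\subset\mathcal{SC}_H^0$. Moreover: (i) if $f=h+\bar g\in\mathcal{R}_H^0$ with $h(z)=z+\sum_{n\ge2}a_nz^n$, $g(z)=\sum_{n\ge2}b_nz^n$, then $\big||a_n|-|b_n|\big|\le2/n$ for $n=2,3,\dots$, with equality for $f_0(z)=-z-2\log(1-z)=z+\sum_{n\ge2}\frac{2}{n}z^n$; (ii) every $f\in\mathcal{R}_H^0$ satisfies $-|z|+2\log(1+|z|)\le|f(z)|\le-|z|-2\log(1-|z|)$ for $z\in\mathbb{D}$, so the range of $f$ contains the disk $|w|<2\log2-1$; these are sharp for $f_0$; (iii) $\mathcal{R}_H^0$ is compact with respect to the topology of locally uniform convergence; (iv) $r_C(\mathcal{R}_H^0)=\sqrt2-1$ and $r_{CC}(\mathcal{R}_H^0)=1$; (v) if $\varphi\in\mathcal{K}$ and $f\in\mathcal{R}_H^0$, then $f\,\tilde{*}\,\varphi\in\mathcal{R}_H^0$; also, if $\varphi\in\mathcal{A}$ with $\operatorname{Re}\varphi(z)/z>1/2$ for $z\in\mathbb{D}$ and $f\in\mathcal{R}_H^0$, then $f\,\tilde{*}\,\varphi\in\mathcal{R}_H^0$; (vi) $\mathcal{R}_H^0$ is closed under convex combinations of its members.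
   Context: $\mathbb{D}$ is the open unit disk. $\mathcal{H}$ is the class of harmonic $f=h+\bar g$ in $\mathbb{D}$ ($h,g$ analytic) with $f(0)=0$, $f_z(0)=1$, $f_{\bar z}(0)=0$. $\mathcal{A}$ is the class of analytic $f$ in $\mathbb{D}$ with $f(0)=0$, $f'(0)=1$; $\mathcal{S}\subset\mathcal{A}$ the univalent ones; $\mathcal{K}\subset\mathcal{S}$ those mapping $\mathbb{D}$ onto a convex domain; $\mathcal{R}=\{f\in\mathcal{A}:\operatorname{Re}f'(z)>0,\ z\in\mathbb{D}\}$. For $\mathcal{G}\subset\mathcal{S}$, its harmonic analogue is the class of harmonic $f=h+\bar g$ with $h+\epsilon g\in\mathcal{G}$ for every $|\epsilon|=1$. $\mathcal{SC}_H^0$ is the class of sense-preserving ($|g'|<|h'|$) univalent $f=h+\bar g\in\mathcal{H}$ such that $h+\lambda\bar g$ maps $\mathbb{D}$ univalently onto a close-to-convex domain for every $|\lambda|=1$. $r_C$, $r_{CC}$ denote radius of convexity/close-to-convexity: the largest $r\le1$ such that every member of the class maps $|z|<r$ univalently onto a convex (resp. close-to-convex) domain. For analytic $f=\sum a_nz^n$, $\varphi=\sum c_nz^n$, $f*\varphi=\sum a_nc_nz^n$, and for harmonic $f=h+\bar g$, $f\,\tilde{*}\,\varphi=h*\varphi+\overline{g*\varphi}$. Closed under convex combinations: $\sum t_nf_n$ is in the class whenever all $f_n$ are, $t_n\ge0$, $\sum t_n=1$. *)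

theory Defs
  imports "HOL-Analysis.Analysis"
begin

definition unit_disk :: "complex set" where
  "unit_disk = ball 0 1"

text \<open>A harmonic map f = h + conj g is represented by the pair (h, g) of analytic functions.\<close>
definition harm :: "(complex \<Rightarrow> complex) \<times> (complex \<Rightarrow> complex) \<Rightarrow> complex \<Rightarrow> complex" where
  "harm p = (\<lambda>z. fst p z + cnj (snd p z))"

definition classH :: "((complex \<Rightarrow> complex) \<times> (complex \<Rightarrow> complex)) set" where
  "classH = {(h, g). h holomorphic_on unit_disk \<and> g holomorphic_on unit_disk \<and>
      h 0 = 0 \<and> g 0 = 0 \<and> deriv h 0 = 1 \<and> deriv g 0 = 0}"

definition classA :: "(complex \<Rightarrow> complex) set" where
  "classA = {f. f holomorphic_on unit_disk \<and> f 0 = 0 \<and> deriv f 0 = 1}"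

definition classS :: "(complex \<Rightarrow> complex) set" where
  "classS = {f \<in> classA. inj_on f unit_disk}"

definition classK :: "(complex \<Rightarrow> complex) set" where
  "classK = {f \<in> classS. convex (f ` unit_disk)}"

definition classR :: "(complex \<Rightarrow> complex) set" where
  "classR = {f \<in> classA. \<forall>z\<in>unit_disk. Re (deriv f z) > 0}"

definition harm_analogue :: "(complex \<Rightarrow> complex) set \<Rightarrow> ((complex \<Rightarrow> complex) \<times> (complex \<Rightarrow> complex)) set" where
  "harm_analogue G = {(h, g). h holomorphic_on unit_disk \<and> g holomorphic_on unit_disk \<and>
      (\<forall>\<epsilon>. cmod \<epsilon> = 1 \<longrightarrow> (\<lambda>z. h z + \<epsilon> * g z) \<in> G)}"

text \<open>Close-to-convex domain (Kaplan / Clunie--Sheil-Small): a domain whose complement is a union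
  of closed half-lines whose relative interiors (open rays) are pairwise disjoint.\<close>
definition closed_ray :: "complex \<Rightarrow> complex \<Rightarrow> complex set" where
  "closed_ray a d = {a + of_real t * d | t. t \<ge> 0}"

definition open_ray :: "complex \<Rightarrow> complex \<Rightarrow> complex set" where
  "open_ray a d = {a + of_real t * d | t. t > 0}"

definition close_to_convex_domain :: "complex set \<Rightarrow> bool" where
  "close_to_convex_domain \<Omega> \<longleftrightarrow> open \<Omega> \<and> connected \<Omega> \<and> \<Omega> \<noteq> {} \<and>
     (\<exists>L :: (complex \<times> complex) set.
        (\<forall>(a, d)\<in>L. d \<noteq> 0) \<and>
        (\<forall>(a, d)\<in>L. \<forall>(a', d')\<in>L. closed_ray a d \<noteq> closed_ray a' d' \<longrightarrow>
             open_ray a d \<inter> open_ray a' d' = {}) \<and>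
        - \<Omega> = (\<Union>(a, d)\<in>L. closed_ray a d))"

definition classSCH0 :: "((complex \<Rightarrow> complex) \<times> (complex \<Rightarrow> complex)) set" where
  "classSCH0 = {(h, g) \<in> classH.
      (\<forall>z\<in>unit_disk. cmod (deriv g z) < cmod (deriv h z)) \<and>
      inj_on (harm (h, g)) unit_disk \<and>
      (\<forall>c. cmod c = 1 \<longrightarrow> inj_on (\<lambda>z. h z + c * cnj (g z)) unit_disk \<and>
          close_to_convex_domain ((\<lambda>z. h z + c * cnj (g z)) ` unit_disk))}"

definition classRH0 :: "((complex \<Rightarrow> complex) \<times> (complex \<Rightarrow> complex)) set" where
  "classRH0 = {(h, g) \<in> classH. \<forall>z\<in>unit_disk. Re (deriv h z) > cmod (deriv g z)}"

definition coef :: "(complex \<Rightarrow> complex) \<Rightarrow> nat \<Rightarrow> complex" where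
  "coef f n = (deriv ^^ n) f 0 / fact n"

definition hadamard :: "(complex \<Rightarrow> complex) \<Rightarrow> (complex \<Rightarrow> complex) \<Rightarrow> complex \<Rightarrow> complex" where
  "hadamard f \<phi> = (\<lambda>z. \<Sum>n. coef f n * coef \<phi> n * z ^ n)"

definition harm_conv :: "(complex \<Rightarrow> complex) \<times> (complex \<Rightarrow> complex) \<Rightarrow> (complex \<Rightarrow> complex)
     \<Rightarrow> (complex \<Rightarrow> complex) \<times> (complex \<Rightarrow> complex)" where
  "harm_conv p \<phi> = (hadamard (fst p) \<phi>, hadamard (snd p) \<phi>)"

definition radius_convexity :: "(complex \<Rightarrow> complex) set \<Rightarrow> real" where
  "radius_convexity F = Sup {r. 0 < r \<and> r \<le> 1 \<and>
      (\<forall>f\<in>F. inj_on f (ball 0 r) \<and> convex (f ` ball 0 r))}"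

definition radius_ctc :: "(complex \<Rightarrow> complex) set \<Rightarrow> real" where
  "radius_ctc F = Sup {r. 0 < r \<and> r \<le> 1 \<and>
      (\<forall>f\<in>F. inj_on f (ball 0 r) \<and> close_to_convex_domain (f ` ball 0 r))}"

definition f0 :: "(complex \<Rightarrow> complex) \<times> (complex \<Rightarrow> complex)" where
  "f0 = ((\<lambda>z. - z - 2 * Ln (1 - z)), (\<lambda>z. 0))"

end

theory Submission
  imports Defs "HOL-Complex_Analysis.Complex_Analysis"
begin

text \<open>For a member \<open>(h, g)\<close> of the class, every \<open>deriv h + \<epsilon> * deriv g\<close> with \<open>cmod \<epsilon> = 1\<close> is a function
  of positive real part with value \<open>1\<close> at \<open>0\<close>. Coefficient bound, growth, compactness and the
  convolution results follow from the classical theory of such functions.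

  The map \<open>f = h + c * cnj g\<close> with \<open>cmod c = 1\<close> satisfies \<open>(f z - f w) \<bullet> (z - w) > 0\<close> for distinct \<open>z\<close> and \<open>w\<close>.
  Such a strictly monotone map on the disk has a maximal monotone extension to the closed
  disk that covers the plane; its values over the boundary points \<open>\<zeta>\<close> are disjoint and consist of rays
  in the direction \<open>\<zeta>\<close>, which exhibits the image of the disk as close-to-convex without any
  boundary regularity.

  Convexity of the image of a circle of radius \<open>sqrt 2 - 1\<close> amounts to monotonicity of the tangent
  angle. For the analytic functions \<open>h + \<epsilon> * g\<close> it follows from the Schwarz--Pick inequality, and
  it passes from all of them to \<open>h + cnj g\<close> pointwise.\<close>

section \<open>Strictly monotone maps of a ball\<close>

text \<open>The obstacle is the boundary: \<open>deriv h\<close> may be unbounded, as it is for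
  \<open>f0\<close>, so the image of the unit circle need not be a curve with a tangent. Set-valued
  boundary values replace it, and the same extension yields the covering disk and the point omitted
  by \<open>f0\<close>. The extremal function of positive real part is
  \<open>(1 + z) / (1 - z)\<close>, the derivative of \<open>f0\<close>. Its coefficients give the
  bound \<open>2 / n\<close>; its values at \<open>r\<close> and \<open>- r\<close>, integrated over
  the radius, give the two growth bounds. The number \<open>sqrt 2 - 1\<close> is the positive root
  of \<open>2 * r = 1 - r\<^sup>2\<close>: Schwarz--Pick bounds \<open>z * deriv P z\<close> by
  \<open>2 * r / (1 - r\<^sup>2)\<close> times \<open>Re (P z)\<close> for
  \<open>r = cmod z\<close>, and convexity needs this factor to be at most 1. Both convolution
  statements reduce to \<open>1 / 2 \<le> Re (\<phi> z / z)\<close>; for convex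
  \<open>\<phi>\<close> this is the inequality of Marx and Strohhaecker.\<close>

definition strictly_monotone_on :: "'a::real_inner set \<Rightarrow> ('a \<Rightarrow> 'a) \<Rightarrow> bool" where
  "strictly_monotone_on S f \<longleftrightarrow> (\<forall>z\<in>S. \<forall>w\<in>S. z \<noteq> w \<longrightarrow> 0 < (f z - f w) \<bullet> (z - w))"

lemma strictly_monotone_on_le:
  assumes "strictly_monotone_on S f" "z \<in> S" "w \<in> S"
  shows "0 \<le> (f z - f w) \<bullet> (z - w)"
  using assms by (cases "z = w") (auto simp: strictly_monotone_on_def less_imp_le)

lemma strictly_monotone_on_imp_inj_on:
  assumes "strictly_monotone_on S f" shows "inj_on f S"
  using assms unfolding strictly_monotone_on_def inj_on_def
  by (metis diff_self inner_zero_left less_irrefl)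

text \<open>The values at \<^term>\<open>x\<close> of the maximal monotone extension of \<^term>\<open>f\<close>.\<close>
definition monotone_ext :: "'a::real_inner set \<Rightarrow> ('a \<Rightarrow> 'a) \<Rightarrow> 'a \<Rightarrow> 'a set" where
  "monotone_ext S f x = {y. \<forall>w\<in>S. 0 \<le> (f w - y) \<bullet> (w - x)}"

text \<open>Testing at \<open>x + s *\<^sub>R v\<close> with \<open>v = y - f x\<close> and letting
  \<open>s\<close> tend to 0 turns the defining inequality into
  \<open>0 \<le> - (v \<bullet> v)\<close>.\<close>

lemma monotone_ext_interior:
  assumes "open S" "continuous_on S f" "x \<in> S" "y \<in> monotone_ext S f x"
  shows "y = f x"
proof -
  define v where "v = y - f x"
  have "((\<lambda>s. x + s *\<^sub>R v) \<longlongrightarrow> x + 0 *\<^sub>R v) (at_right 0)"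
    by (intro tendsto_intros)
  then have lim: "((\<lambda>s. x + s *\<^sub>R v) \<longlongrightarrow> x) (at_right 0)" by simp
  have evS: "eventually (\<lambda>s. x + s *\<^sub>R v \<in> S) (at_right (0::real))"
    using lim assms(1,3) by (rule topological_tendstoD)
  have "isCont f x" using assms(1-3) continuous_on_eq_continuous_at by blast
  then have "((\<lambda>s. f (x + s *\<^sub>R v)) \<longlongrightarrow> f x) (at_right 0)"
    using lim isCont_tendsto_compose by blast
  then have "((\<lambda>s. (f (x + s *\<^sub>R v) - y) \<bullet> v) \<longlongrightarrow> (f x - y) \<bullet> v) (at_right 0)"
    by (intro tendsto_intros)
  moreover have "eventually (\<lambda>s. 0 \<le> (f (x + s *\<^sub>R v) - y) \<bullet> v) (at_right (0::real))"
    using evS eventually_at_right_less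
  proof eventually_elim
    case (elim s)
    then have "0 \<le> (f (x + s *\<^sub>R v) - y) \<bullet> (s *\<^sub>R v)"
      using assms(4) unfolding monotone_ext_def by fastforce
    then show ?case using elim by (simp add: zero_le_mult_iff)
  qed
  ultimately have "0 \<le> (f x - y) \<bullet> v"
    by (intro tendsto_lowerbound) auto
  moreover have "(f x - y) \<bullet> v = - (v \<bullet> v)"
    by (simp add: v_def inner_diff_left inner_diff_right inner_commute)
  ultimately have "v = 0" by (metis inner_gt_zero_iff neg_0_le_iff_le not_le)
  then show ?thesis by (simp add: v_def)
qed

text \<open>Minty's surjectivity of maximal monotone operators with bounded domain. On a smaller closed
  ball the solution of the variational inequality is a fixed point of the projection of
  \<^term>\<open>x - (f x - y)\<close>.\<close>
lemma monotone_ext_surj: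
  fixes f :: "'a::euclidean_space \<Rightarrow> 'a"
  assumes r: "0 < r" and cont: "continuous_on (ball 0 r) f"
    and mono: "strictly_monotone_on (ball 0 r) f"
  obtains x where "x \<in> cball 0 r" "y \<in> monotone_ext (ball 0 r) f x"
proof -
  have ex: "\<exists>x\<in>cball 0 s. \<forall>w\<in>cball 0 s. 0 \<le> (f w - y) \<bullet> (w - x)" if s: "0 < s" "s < r" for s
  proof -
    have sub: "cball (0::'a) s \<subseteq> ball 0 r" using s by auto
    define F where "F = (\<lambda>x. closest_point (cball 0 s) (x - (f x - y)))"
    have "continuous_on (cball 0 s) (\<lambda>x. x - (f x - y))"
      by (intro continuous_intros continuous_on_subset[OF cont sub])
    then have "continuous_on (cball 0 s) F"
      unfolding F_def using s
      by (intro continuous_on_compose2[OF continuous_on_closest_point[of "cball 0 s" UNIV]]) auto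
    moreover have "F \<in> cball 0 s \<rightarrow> cball 0 s"
      unfolding F_def using s by (intro funcsetI closest_point_in_set) auto
    ultimately obtain x where x: "x \<in> cball 0 s" "F x = x"
      using brouwer[of "cball 0 s" F] s by auto
    have "0 \<le> (f w - y) \<bullet> (w - x)" if w: "w \<in> cball 0 s" for w
    proof -
      have "(x - (f x - y) - F x) \<bullet> (w - F x) \<le> 0"
        unfolding F_def by (rule closest_point_dot) (use w in auto)
      then have "0 \<le> (f x - y) \<bullet> (w - x)"
        by (simp add: x(2) inner_diff_left inner_diff_right algebra_simps)
      \<comment> \<open>Minty's trick: monotonicity replaces \<open>f x\<close> by
        \<open>f w\<close>. The inequality then no longer evaluates \<open>f\<close> at the moving
        point \<open>x\<close> and survives a limit in which \<open>x\<close> reaches the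
        boundary.\<close>
      moreover have "0 \<le> (f w - f x) \<bullet> (w - x)"
        by (rule strictly_monotone_on_le[OF mono]) (use w x sub in auto)
      ultimately show ?thesis by (simp add: inner_diff_left)
    qed
    then show ?thesis using x(1) by blast
  qed
  \<comment> \<open>The shift by 2 keeps the radii strictly between 0 and \<open>r\<close> already
    at \<open>n = 0\<close>.\<close>
  define s where "s = (\<lambda>n. r * (1 - 1 / real (n + 2)))"
  have s: "0 < s n" "s n < r" for n using r by (auto simp: s_def field_simps add_pos_nonneg)
  have slim: "s \<longlonglongrightarrow> r"
    unfolding s_def by real_asymp
  from ex[OF s] have "\<forall>n. \<exists>x\<in>cball 0 (s n). \<forall>w\<in>cball 0 (s n). 0 \<le> (f w - y) \<bullet> (w - x)" by blast
  then obtain X where X: "\<And>n. X n \<in> cball 0 (s n)"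
      and Xw: "\<And>n w. w \<in> cball 0 (s n) \<Longrightarrow> 0 \<le> (f w - y) \<bullet> (w - X n)" by metis
  have "\<forall>n. X n \<in> cball 0 r" using X s(2) by (metis less_imp_le order_trans mem_cball_0)
  then obtain l k where l: "l \<in> cball 0 r" "strict_mono k" "(X \<circ> k) \<longlonglongrightarrow> l"
    using compact_cball[of "0::'a" r] unfolding compact_def by blast
  have "0 \<le> (f w - y) \<bullet> (w - l)" if w: "w \<in> ball 0 r" for w
  proof (rule tendsto_lowerbound)
    show "((\<lambda>n. (f w - y) \<bullet> (w - (X \<circ> k) n)) \<longlongrightarrow> (f w - y) \<bullet> (w - l)) sequentially"
      by (intro tendsto_intros l)
    have "(s \<circ> k) \<longlonglongrightarrow> r" using slim l(2) by (rule LIMSEQ_subseq_LIMSEQ)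
    then have "eventually (\<lambda>n. norm w < (s \<circ> k) n) sequentially"
      by (rule order_tendstoD) (use w in auto)
    then show "\<forall>\<^sub>F n in sequentially. 0 \<le> (f w - y) \<bullet> (w - (X \<circ> k) n)"
      by eventually_elim (auto intro: Xw)
  qed auto
  then show ?thesis using that[of l] l(1) by (auto simp: monotone_ext_def)
qed

text \<open>If \<open>y = f v\<close>, take \<open>w\<close> slightly displaced from
  \<open>v\<close> towards \<open>x\<close>. Strict monotonicity makes \<open>f w - f v\<close>
  point towards \<open>x\<close>, while the inequality defining the extension, tested at
  \<open>w\<close>, makes it point away.\<close>

lemma monotone_ext_frontier_notin_image:
  assumes mono: "strictly_monotone_on S f" and "open S" "x \<notin> S"
    and y: "y \<in> monotone_ext S f x"
  shows "y \<notin> f ` S"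
proof
  assume "y \<in> f ` S"
  then obtain v where v: "v \<in> S" "y = f v" by auto
  have "((\<lambda>s. v + s *\<^sub>R (x - v)) \<longlongrightarrow> v + 0 *\<^sub>R (x - v)) (at_right 0)"
    by (intro tendsto_intros)
  then have lim: "((\<lambda>s. v + s *\<^sub>R (x - v)) \<longlongrightarrow> v) (at_right 0)" by simp
  have "eventually (\<lambda>s. v + s *\<^sub>R (x - v) \<in> S) (at_right (0::real))"
    using lim assms(2) v(1) by (rule topological_tendstoD)
  moreover have "eventually (\<lambda>s. s < 1) (at_right (0::real))"
    by (rule eventually_at_right_real[of 0 1, THEN eventually_mono]) auto
  ultimately have "eventually (\<lambda>s. s < 1 \<and> 0 < s \<and> v + s *\<^sub>R (x - v) \<in> S) (at_right (0::real))"
    using eventually_at_right_less by eventually_elim auto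
  then obtain s where s: "s < 1" "0 < s" "v + s *\<^sub>R (x - v) \<in> S"
    using eventually_happens trivial_limit_at_right_real by blast
  define w where "w = v + s *\<^sub>R (x - v)"
  have "x \<noteq> v" using v assms(3) by auto
  then have "w \<noteq> v" using s by (simp add: w_def)
  then have "0 < (f w - f v) \<bullet> (w - v)"
    using mono s v unfolding strictly_monotone_on_def w_def by blast
  moreover have "w - v = s *\<^sub>R (x - v)" by (simp add: w_def)
  ultimately have 1: "0 < (f w - f v) \<bullet> (x - v)" using s by (simp add: zero_less_mult_iff)
  have "w - x = - ((1 - s) *\<^sub>R (x - v))" by (simp add: w_def algebra_simps)
  moreover have "0 \<le> (f w - y) \<bullet> (w - x)"
    using y s unfolding monotone_ext_def w_def by blast
  ultimately have "0 \<le> - ((1 - s) * ((f w - f v) \<bullet> (x - v)))" using v by simp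
  then show False using 1 s by (simp add: mult_le_0_iff)
qed

text \<open>The defining inequality is affine in the base point, so a common value would also be a
  value at the midpoint. By strict convexity of the ball the midpoint is interior, where the only
  value lies in the image, whereas values over boundary points do not.\<close>

lemma monotone_ext_disjoint:
  fixes f :: "'a::euclidean_space \<Rightarrow> 'a"
  assumes mono: "strictly_monotone_on (ball 0 r) f" and cont: "continuous_on (ball 0 r) f"
    and x: "norm x = r" "norm x' = r" "x \<noteq> x'"
  shows "monotone_ext (ball 0 r) f x \<inter> monotone_ext (ball 0 r) f x' = {}"
proof (rule ccontr)
  assume "\<not> ?thesis"
  then obtain y where y: "y \<in> monotone_ext (ball 0 r) f x" "y \<in> monotone_ext (ball 0 r) f x'"
    by blast
  define m where "m = midpoint x x'"
  have m: "m \<in> ball 0 r"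
  proof -
    have "0 \<le> r" using x by auto
    have "(norm (x + x'))\<^sup>2 + (norm (x - x'))\<^sup>2 = (2 * r)\<^sup>2"
      using dot_norm_neg[of x x'] dot_norm[of x x'] x by (simp add: power_mult_distrib)
    moreover have "0 < (norm (x - x'))\<^sup>2" using x by simp
    ultimately have "(norm (x + x'))\<^sup>2 < (2 * r)\<^sup>2" by linarith
    then have "norm (x + x') < 2 * r" by (rule power2_less_imp_less) (use \<open>0 \<le> r\<close> in auto)
    then show ?thesis by (simp add: m_def midpoint_def)
  qed
  have "y \<in> monotone_ext (ball 0 r) f m"
  proof -
    have "(f w - y) \<bullet> (w - m) = ((f w - y) \<bullet> (w - x) + (f w - y) \<bullet> (w - x')) / 2" for w
      by (simp add: m_def midpoint_def inner_diff_right inner_add_right algebra_simps)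
    then show ?thesis using y by (simp add: monotone_ext_def del: eq_divide_eq_numeral1)
  qed
  then have "y = f m" using monotone_ext_interior[OF open_ball cont m] by blast
  moreover have "y \<notin> f ` ball 0 r"
    by (rule monotone_ext_frontier_notin_image[OF mono _ _ y(1)]) (use x in auto)
  ultimately show False using m by blast
qed

text \<open>The vector \<open>\<zeta>\<close> is an outer normal of the ball at the point
  \<open>\<zeta>\<close>: its inner product with \<open>w - \<zeta>\<close> is nonpositive for all
  \<open>w\<close> in the ball. This is the source of the rays.\<close>

lemma monotone_ext_add_normal:
  assumes "norm \<zeta> = r" "0 \<le> t" "y \<in> monotone_ext (ball 0 r) f \<zeta>"
  shows "y + t *\<^sub>R \<zeta> \<in> monotone_ext (ball 0 r) f \<zeta>"
proof -
  have "0 \<le> (f w - (y + t *\<^sub>R \<zeta>)) \<bullet> (w - \<zeta>)" if "w \<in> ball 0 r" for w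
  proof -
    have "\<zeta> \<bullet> w \<le> \<zeta> \<bullet> \<zeta>"
      using norm_cauchy_schwarz[of \<zeta> w] that assms(1)
      by (smt (verit) mem_ball_0 mult_left_mono norm_ge_zero power2_eq_square power2_norm_eq_inner)
    then have "0 \<le> t * (\<zeta> \<bullet> \<zeta> - \<zeta> \<bullet> w)" using assms(2) by simp
    moreover have "0 \<le> (f w - y) \<bullet> (w - \<zeta>)" using assms(3) that by (auto simp: monotone_ext_def)
    ultimately show ?thesis by (simp add: inner_diff_left inner_diff_right inner_add_left algebra_simps)
  qed
  then show ?thesis by (simp add: monotone_ext_def)
qed

text \<open>Testing at the centre alone limits how far a ray can be prolonged backwards, so that it
  has an endpoint.\<close>

lemma monotone_ext_normal_bounded_below:
  assumes r: "0 < r" "norm \<zeta> = r" and y: "y - t *\<^sub>R \<zeta> \<in> monotone_ext (ball 0 r) f \<zeta>"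
  shows "t \<le> (y - f 0) \<bullet> \<zeta> / r\<^sup>2"
proof -
  have "0 \<le> (f 0 - (y - t *\<^sub>R \<zeta>)) \<bullet> (0 - \<zeta>)"
    using y r unfolding monotone_ext_def by (metis (no_types, lifting) centre_in_ball mem_Collect_eq)
  then have "t * (\<zeta> \<bullet> \<zeta>) \<le> (y - f 0) \<bullet> \<zeta>"
    by (simp add: inner_diff_left inner_add_left algebra_simps)
  then show ?thesis using r by (simp add: field_simps flip: power2_norm_eq_inner)
qed

lemma closed_monotone_ext: "closed (monotone_ext S f x)"
proof -
  have "monotone_ext S f x = (\<Inter>w\<in>S. {y. 0 \<le> (f w - y) \<bullet> (w - x)})"
    by (auto simp: monotone_ext_def)
  also have "closed \<dots>"
    by (intro closed_INT ballI closed_Collect_le continuous_intros)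
  finally show ?thesis .
qed

text \<open>The complement of the image is the disjoint union of the sets \<^term>\<open>monotone_ext (ball 0 r) f \<zeta>\<close>
  with \<^term>\<open>norm \<zeta> = r\<close>, and each of them is a disjoint union of rays in the direction of \<^term>\<open>\<zeta>\<close>.\<close>
lemma close_to_convex_domain_strictly_monotone:
  assumes r: "0 < r" and cont: "continuous_on (ball 0 r) f"
    and mono: "strictly_monotone_on (ball 0 r) f"
  shows "close_to_convex_domain (f ` ball 0 r)"
proof -
  let ?N = "monotone_ext (ball 0 r) f"
  \<comment> \<open>Only maximal rays are collected: \<open>a\<close> is a value from which no step
    backwards along \<open>\<zeta>\<close> gives another value. Without this, rays with the same
    direction could overlap.\<close>
  define L where "L = {(a, \<zeta>). norm \<zeta> = r \<and> a \<in> ?N \<zeta> \<and> (\<forall>t>0. a - t *\<^sub>R \<zeta> \<notin> ?N \<zeta>)}"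
  have rayN: "a + of_real t * \<zeta> \<in> ?N \<zeta>" if "(a, \<zeta>) \<in> L" "0 \<le> t" for a \<zeta> t
    using that monotone_ext_add_normal[of \<zeta> r t a f] by (auto simp: L_def scaleR_conv_of_real)
  have "open (f ` ball 0 r)"
    using invariance_of_domain[OF cont open_ball strictly_monotone_on_imp_inj_on[OF mono]] .
  moreover have "connected (f ` ball 0 r)"
    using cont by (rule connected_continuous_image) simp
  moreover have "f ` ball 0 r \<noteq> {}" using r by simp
  moreover have "\<forall>(a, d)\<in>L. d \<noteq> 0" using r by (auto simp: L_def)
  moreover have "\<forall>(a, d)\<in>L. \<forall>(a', d')\<in>L. closed_ray a d \<noteq> closed_ray a' d' \<longrightarrow>
             open_ray a d \<inter> open_ray a' d' = {}"
  proof -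
    have False if L: "(a, d) \<in> L" "(a', d') \<in> L" and ne: "closed_ray a d \<noteq> closed_ray a' d'"
      and y: "y \<in> open_ray a d" "y \<in> open_ray a' d'" for a d a' d' y
    proof -
      obtain t t' where t: "0 < t" "y = a + of_real t * d" "0 < t'" "y = a' + of_real t' * d'"
        using y unfolding open_ray_def by blast
      then have "y \<in> ?N d" "y \<in> ?N d'" using rayN[OF L(1), of t] rayN[OF L(2), of t'] by auto
      then have [simp]: "d' = d"
        using monotone_ext_disjoint[OF mono cont, of d d'] L by (auto simp: L_def)
      have min: "\<And>s. 0 < s \<Longrightarrow> a - s *\<^sub>R d \<notin> ?N d" "\<And>s. 0 < s \<Longrightarrow> a' - s *\<^sub>R d \<notin> ?N d"
        and mem: "a \<in> ?N d" "a' \<in> ?N d" using L by (simp_all add: L_def)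
      \<comment> \<open>Two rays through \<open>y\<close> with the same direction lie on one line,
        so if their endpoints differed, one of them would lie behind the other, against
        maximality.\<close>
      have eq: "a' = a - (t' - t) *\<^sub>R d" "a = a' - (t - t') *\<^sub>R d"
        using t by (simp_all add: scaleR_conv_of_real algebra_simps)
      have "\<not> 0 < t' - t" using min(1)[of "t' - t"] mem(2) eq(1) by metis
      moreover have "\<not> 0 < t - t'" using min(2)[of "t - t'"] mem(1) eq(2) by metis
      ultimately have "t = t'" by simp
      then show False using t ne by auto
    qed
    then show ?thesis by blast
  qed
  moreover have "- (f ` ball 0 r) = (\<Union>(a, d)\<in>L. closed_ray a d)"
  proof (intro equalityI subsetI)
    fix y assume y: "y \<in> - (f ` ball 0 r)"
    obtain \<zeta> where \<zeta>: "\<zeta> \<in> cball 0 r" "y \<in> ?N \<zeta>" using monotone_ext_surj[OF r cont mono] .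
    have "\<zeta> \<notin> ball 0 r" using monotone_ext_interior[OF open_ball cont _ \<zeta>(2)] y by blast
    then have n: "norm \<zeta> = r" using \<zeta> by auto
    \<comment> \<open>The lengths by which the ray can be followed back from \<open>y\<close>. The
      supremum is attained because \<open>T\<close> is bounded and closed, and it gives the
      endpoint.\<close>
    define T where "T = {t. 0 \<le> t \<and> y - t *\<^sub>R \<zeta> \<in> ?N \<zeta>}"
    have bdd: "bdd_above T"
      unfolding T_def using monotone_ext_normal_bounded_below[OF r n] by (auto intro!: bdd_aboveI)
    have "0 \<in> T" using \<zeta> by (simp add: T_def)
    have "T = {0..} \<inter> (\<lambda>t. y - t *\<^sub>R \<zeta>) -` ?N \<zeta>" by (auto simp: T_def)
    also have "closed \<dots>"
      by (intro closed_Int closed_vimage closed_monotone_ext continuous_intros closed_atLeast)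
    finally have "Sup T \<in> T" using closed_contains_Sup[OF _ bdd] \<open>0 \<in> T\<close> by blast
    define a where "a = y - Sup T *\<^sub>R \<zeta>"
    have "a - t *\<^sub>R \<zeta> \<notin> ?N \<zeta>" if "0 < t" for t
    proof
      assume "a - t *\<^sub>R \<zeta> \<in> ?N \<zeta>"
      then have "Sup T + t \<in> T"
        using \<open>Sup T \<in> T\<close> that by (simp add: T_def a_def algebra_simps)
      then show False using cSup_upper[OF _ bdd] that by fastforce
    qed
    then have "(a, \<zeta>) \<in> L" using \<open>Sup T \<in> T\<close> n by (auto simp: L_def T_def a_def)
    moreover have "y = a + of_real (Sup T) * \<zeta>" "0 \<le> Sup T"
      using \<open>Sup T \<in> T\<close> by (simp_all add: a_def T_def scaleR_conv_of_real)
    then have "y \<in> closed_ray a \<zeta>" unfolding closed_ray_def by blast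
    ultimately show "y \<in> (\<Union>(a, d)\<in>L. closed_ray a d)" by blast
  next
    fix y assume "y \<in> (\<Union>(a, d)\<in>L. closed_ray a d)"
    then obtain a d t where adt: "(a, d) \<in> L" "0 \<le> t" "y = a + of_real t * d"
      by (auto simp: closed_ray_def)
    then have "y \<in> ?N d" "d \<notin> ball 0 r" using rayN by (auto simp: L_def)
    then show "y \<in> - (f ` ball 0 r)"
      using monotone_ext_frontier_notin_image[OF mono open_ball] by blast
  qed
  ultimately show ?thesis
    unfolding close_to_convex_domain_def by blast
qed

section \<open>Functions of positive real part\<close>

text \<open>By the open mapping theorem a nonconstant image inside the closed right half plane
  avoids the imaginary axis. This restores strict inequalities that are lost in limits.\<close>

lemma Re_pos_if_Re_nonneg:
  assumes hol: "p holomorphic_on S" and S: "open S" "connected S"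
    and nn: "\<And>z. z \<in> S \<Longrightarrow> 0 \<le> Re (p z)"
    and pos: "a \<in> S" "0 < Re (p a)" and z: "z \<in> S"
  shows "0 < Re (p z)"
proof (cases "p constant_on S")
  case True
  then have "p z = p a" using pos(1) z by (auto simp: constant_on_def)
  then show ?thesis using pos by simp
next
  case False
  have "open (p ` S)"
    using open_mapping_thm[OF hol S _ _ False, of S] S by simp
  then obtain e where e: "0 < e" "ball (p z) e \<subseteq> p ` S"
    using z by (meson imageI openE)
  have "p z - of_real (e / 2) \<in> ball (p z) e" using e by (simp add: dist_norm)
  then obtain w where "w \<in> S" "p w = p z - of_real (e / 2)" using e by (metis imageE subsetD)
  then have "0 \<le> Re (p z) - e / 2" using nn[of w] by simp
  then show ?thesis using e by linarith
qed

text \<open>The Schwarz lemma for the Cayley transform \<open>(p - 1) / (p + 1)\<close>, which fixes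
  0 and has derivative \<open>deriv p 0 / 2\<close> there.\<close>

lemma Caratheodory_Schwarz:
  assumes hol: "p holomorphic_on ball 0 1" and p0: "p 0 = 1"
    and pos: "\<And>z. z \<in> ball 0 1 \<Longrightarrow> 0 < Re (p z)"
  shows "z \<in> ball 0 1 \<Longrightarrow> cmod (p z - 1) \<le> cmod z * cmod (p z + 1)"
    and "cmod (deriv p 0) \<le> 2"
proof -
  define \<phi> where "\<phi> = (\<lambda>z. (p z - 1) / (p z + 1))"
  have nz: "p z + 1 \<noteq> 0" if "z \<in> ball 0 1" for z
    using pos[OF that] by (auto simp: complex_eq_iff)
  have hphi: "\<phi> holomorphic_on ball 0 1"
    unfolding \<phi>_def using nz by (intro holomorphic_intros hol) auto
  have phi0: "\<phi> 0 = 0" by (simp add: \<phi>_def p0)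
  have lt: "cmod (\<phi> z) < 1" if "cmod z < 1" for z
  proof -
    have z: "z \<in> ball 0 1" using that by simp
    have "(cmod (p z - 1))\<^sup>2 < (cmod (p z + 1))\<^sup>2"
      using pos[OF z] unfolding cmod_power2 by (simp add: power2_eq_square algebra_simps)
    then have "cmod (p z - 1) < cmod (p z + 1)" using power2_less_imp_less by fastforce
    then show ?thesis using nz[OF z] by (simp add: \<phi>_def norm_divide)
  qed
  have "(p has_field_derivative deriv p 0) (at 0)"
    using hol by (simp add: holomorphic_derivI)
  then have "(\<phi> has_field_derivative (deriv p 0 / 2)) (at 0)"
    unfolding \<phi>_def by (auto intro!: derivative_eq_intros simp: p0)
  then have "deriv p 0 = 2 * deriv \<phi> 0" by (simp add: DERIV_imp_deriv)
  moreover have "cmod (deriv \<phi> 0) \<le> 1" using Schwarz_Lemma(2)[OF hphi phi0 lt, of 0] by simp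
  ultimately show "cmod (deriv p 0) \<le> 2" by (simp add: norm_mult)
  show "cmod (p z - 1) \<le> cmod z * cmod (p z + 1)" if "z \<in> ball 0 1"
    using Schwarz_Lemma(1)[OF hphi phi0 lt, of z] that nz[OF that]
    by (simp add: \<phi>_def norm_divide field_simps)
qed

lemma Caratheodory_Harnack:
  assumes "p holomorphic_on ball 0 1" and "p 0 = 1"
    and "\<And>z. z \<in> ball 0 1 \<Longrightarrow> 0 < Re (p z)" and z: "z \<in> ball 0 1"
  shows "(1 - cmod z) / (1 + cmod z) \<le> Re (p z)"
    and "cmod (p z) \<le> (1 + cmod z) / (1 - cmod z)"
proof -
  define r where "r = cmod z"
  have r: "0 \<le> r" "r < 1" using z by (auto simp: r_def)
  have le: "cmod (p z - 1) \<le> r * cmod (p z + 1)"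
    unfolding r_def by (rule Caratheodory_Schwarz) fact+
  have "cmod (p z) - 1 \<le> cmod (p z - 1)" using norm_triangle_ineq2[of "p z" 1] by simp
  also have "\<dots> \<le> r * (cmod (p z) + 1)"
    using le norm_triangle_ineq[of "p z" 1] r
    by (smt (verit) mult_left_mono norm_one)
  finally show "cmod (p z) \<le> (1 + cmod z) / (1 - cmod z)"
    using r by (simp add: field_simps flip: r_def)
  define x where "x = Re (p z)"
  have "(cmod (p z - 1))\<^sup>2 \<le> (r * cmod (p z + 1))\<^sup>2"
    by (rule power_mono[OF le]) simp
  \<comment> \<open>This is the disk whose diameter on the real axis runs from
    \<open>(1 - r) / (1 + r)\<close> to \<open>(1 + r) / (1 - r)\<close>.\<close>
  then have "(1 - r\<^sup>2) * (Im (p z))\<^sup>2 + (x * (1 + r) - (1 - r)) * (x * (1 - r) - (1 + r)) \<le> 0"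
    unfolding power_mult_distrib cmod_power2 x_def by (simp add: power2_eq_square algebra_simps)
  moreover have "0 \<le> (1 - r\<^sup>2) * (Im (p z))\<^sup>2"
    using r by (simp add: power_le_one)
  ultimately have neg: "(x * (1 + r) - (1 - r)) * (x * (1 - r) - (1 + r)) \<le> 0" by linarith
  have "1 - r \<le> x * (1 + r)"
  proof (rule ccontr)
    assume a: "\<not> 1 - r \<le> x * (1 + r)"
    moreover have "0 < x" using assms(3)[OF z] by (simp add: x_def)
    then have "x * (1 - r) \<le> x * (1 + r)" using r by (intro mult_left_mono) auto
    ultimately have "x * (1 - r) - (1 + r) < 0" using r by linarith
    then show False using a neg by (simp add: mult_le_0_iff)
  qed
  then show "(1 - cmod z) / (1 + cmod z) \<le> Re (p z)"
    using r by (simp add: field_simps flip: r_def x_def)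
qed

text \<open>A disk automorphism \<open>m\<close> moves 0 to \<open>a\<close>, and an affine map of
  the half plane sends \<open>p a\<close> to 1. The composition \<open>q\<close> is normalised, so
  its derivative at 0 is bounded by 2.\<close>

lemma Schwarz_Pick_Re_pos:
  assumes hol: "p holomorphic_on ball 0 1"
    and pos: "\<And>z. z \<in> ball 0 1 \<Longrightarrow> 0 < Re (p z)" and a: "a \<in> ball 0 1"
  shows "(1 - (cmod a)\<^sup>2) * cmod (deriv p a) \<le> 2 * Re (p a)"
proof -
  define m where "m = (\<lambda>z. (z + a) / (1 + cnj a * z))"
  have m_eq: "m z = Moebius_function 0 (- a) z" for z
    by (simp add: m_def Moebius_function_def)
  have "Moebius_function 0 (- a) holomorphic_on ball 0 1"
    using a by (intro Moebius_function_holomorphic) auto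
  then have hm: "m holomorphic_on ball 0 1" by (simp add: m_eq cong: holomorphic_cong)
  have mb: "m ` ball 0 1 \<subseteq> ball 0 1"
    using Moebius_function_norm_lt_1[of "- a"] a by (auto simp: m_eq)
  have m0: "m 0 = a" by (simp add: m_def)
  define q where "q = (\<lambda>z. (p (m z) - \<i> * of_real (Im (p a))) / of_real (Re (p a)))"
  have pa: "0 < Re (p a)" using pos[OF a] .
  have hq: "q holomorphic_on ball 0 1"
    unfolding q_def using pa
    by (intro holomorphic_intros holomorphic_on_compose_gen[OF hm hol mb, unfolded o_def]) auto
  have q0: "q 0 = 1" using pa by (auto simp: q_def m0 complex_eq_iff Re_divide Im_divide power2_eq_square)
  have qpos: "0 < Re (q z)" if "z \<in> ball 0 1" for z
    using pos[of "m z"] that mb pa by (simp add: q_def image_subset_iff)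
  have dm: "(m has_field_derivative (1 - a * cnj a)) (at 0)"
    unfolding m_def by (auto intro!: derivative_eq_intros simp: mult.commute)
  have "(p has_field_derivative deriv p a) (at (m 0))"
    using hol a by (simp add: holomorphic_derivI m0)
  from DERIV_chain2[OF this dm]
  have "(q has_field_derivative (deriv p a * (1 - a * cnj a) / of_real (Re (p a)))) (at 0)"
    unfolding q_def using pa by (auto intro!: derivative_eq_intros)
  then have "deriv q 0 = deriv p a * (1 - a * cnj a) / of_real (Re (p a))"
    by (rule DERIV_imp_deriv)
  moreover have "1 - a * cnj a = of_real (1 - (cmod a)\<^sup>2)"
    using complex_norm_square[of a] by simp
  moreover have "0 \<le> 1 - (cmod a)\<^sup>2" using a by (simp add: power_le_one)
  ultimately have "cmod (deriv q 0) = cmod (deriv p a) * (1 - (cmod a)\<^sup>2) / Re (p a)"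
    using pa by (simp only: norm_divide norm_mult norm_of_real abs_of_pos abs_of_nonneg)
  then show ?thesis
    using mult_left_mono[OF Caratheodory_Schwarz(2)[OF hq q0 qpos], of "Re (p a)"] pa
    by (simp add: mult.commute)
qed

section \<open>Discrete orthogonality and power series coefficients\<close>

text \<open>A geometric sum over an \<open>M\<close>-th root of unity, which differs from 1 because
  a nonzero \<open>n\<close> of modulus below \<open>M\<close> is not a multiple of
  \<open>M\<close>. The exponent is an integer since differences of degrees have both signs.\<close>

lemma sum_cis_powers:
  fixes n :: int
  assumes M: "\<bar>n\<bar> < int M"
  shows "(\<Sum>k<M. cis (2 * pi * real_of_int n / real M) ^ k) = (if n = 0 then of_nat M else 0)"
proof (cases "n = 0")
  case False
  let ?x = "cis (2 * pi * real_of_int n / real M)"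
  have "?x \<noteq> 1"
  proof
    assume "?x = 1"
    then have "cos (2 * pi * real_of_int n / real M) = 1" by (simp add: complex_eq_iff)
    then obtain j :: int where "2 * pi * real_of_int n / real M = real_of_int j * 2 * pi"
      using cos_one_2pi_int by blast
    then have "real_of_int n = real_of_int j * real M" using M by (simp add: field_simps)
    then have "n = j * int M" by (metis of_int_eq_iff of_int_mult of_int_of_nat_eq)
    then have "\<bar>n\<bar> = \<bar>j\<bar> * int M" by (simp add: abs_mult)
    moreover have "1 \<le> \<bar>j\<bar>" using False \<open>n = j * int M\<close> by auto
    ultimately have "int M \<le> \<bar>n\<bar>" by (simp add: mult_le_cancel_right1)
    then show False using M by simp
  qed
  moreover have "?x ^ M = 1"
  proof -
    have "real M * (2 * pi * real_of_int n / real M) = 2 * pi * real_of_int n" using M by simp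
    then show ?thesis unfolding Complex.DeMoivre by (simp only: cis_multiple_2pi Ints_of_int)
  qed
  ultimately show ?thesis using False by (simp add: geometric_sum)
qed auto

text \<open>Averages over roots of unity of order exceeding both degrees together take the place of
  integrals over the circle (and of the Herglotz representation).\<close>
lemma sum_roots_unity_mult_Re:
  fixes a b :: "nat \<Rightarrow> complex"
  assumes M: "2 * N < M"
  defines "u \<equiv> \<lambda>k. cis (2 * pi / real M) ^ k"
  shows "(\<Sum>k<M. (\<Sum>i\<le>N. a i * cnj (u k) ^ i) * of_real (2 * Re (\<Sum>j\<le>N. b j * u k ^ j)))
    = of_nat M * ((\<Sum>j\<le>N. a j * b j) + a 0 * cnj (b 0))"
proof -
  have pw: "cnj (u k) ^ i * u k ^ j = cis (2 * pi * real_of_int (int j - int i) / real M) ^ k" for k i j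
    unfolding u_def by (simp add: cis_cnj Complex.DeMoivre cis_mult algebra_simps diff_divide_distrib)
  have pw2: "cnj (u k) ^ i * cnj (u k) ^ j = cis (2 * pi * real_of_int (- int i - int j) / real M) ^ k" for k i j
    unfolding u_def by (simp add: cis_cnj Complex.DeMoivre cis_mult algebra_simps diff_divide_distrib)
  have 1: "(\<Sum>k<M. (\<Sum>i\<le>N. a i * cnj (u k) ^ i) * (\<Sum>j\<le>N. b j * u k ^ j))
      = of_nat M * (\<Sum>j\<le>N. a j * b j)"
  proof -
    have "(\<Sum>k<M. (\<Sum>i\<le>N. a i * cnj (u k) ^ i) * (\<Sum>j\<le>N. b j * u k ^ j))
       = (\<Sum>k<M. \<Sum>i\<le>N. \<Sum>j\<le>N. a i * b j * (cnj (u k) ^ i * u k ^ j))"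
      by (simp only: sum_product) (simp only: mult_ac)
    also have "\<dots> = (\<Sum>i\<le>N. \<Sum>k<M. \<Sum>j\<le>N. a i * b j * (cnj (u k) ^ i * u k ^ j))"
      by (rule sum.swap)
    also have "\<dots> = (\<Sum>i\<le>N. \<Sum>j\<le>N. \<Sum>k<M. a i * b j * (cnj (u k) ^ i * u k ^ j))"
      by (intro sum.cong refl sum.swap)
    also have "\<dots> = (\<Sum>i\<le>N. \<Sum>j\<le>N. a i * b j * (if j = i then of_nat M else 0))"
      using M unfolding pw sum_distrib_left[symmetric]
      by (intro sum.cong refl arg_cong2[where f = "(*)"], subst sum_cis_powers) auto
    also have "\<dots> = (\<Sum>i\<le>N. of_nat M * (a i * b i))"
      by (intro sum.cong refl) (simp add: if_distrib[of "(*) _"] cong: if_cong)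
    finally show ?thesis by (simp add: sum_distrib_left)
  qed
  \<comment> \<open>Against the conjugate polynomial the exponents are \<open>- (i + j)\<close>,
    which can be as low as \<open>- 2 * N\<close>; the bound \<open>2 * N < M\<close> leaves only
    \<open>i = j = 0\<close>.\<close>
  have 2: "(\<Sum>k<M. (\<Sum>i\<le>N. a i * cnj (u k) ^ i) * cnj (\<Sum>j\<le>N. b j * u k ^ j))
      = of_nat M * (a 0 * cnj (b 0))"
  proof -
    have "(\<Sum>k<M. (\<Sum>i\<le>N. a i * cnj (u k) ^ i) * cnj (\<Sum>j\<le>N. b j * u k ^ j))
       = (\<Sum>k<M. \<Sum>i\<le>N. \<Sum>j\<le>N. a i * cnj (b j) * (cnj (u k) ^ i * cnj (u k) ^ j))"
      by (simp only: cnj_sum complex_cnj_mult complex_cnj_power sum_product) (simp only: mult_ac)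
    also have "\<dots> = (\<Sum>i\<le>N. \<Sum>k<M. \<Sum>j\<le>N. a i * cnj (b j) * (cnj (u k) ^ i * cnj (u k) ^ j))"
      by (rule sum.swap)
    also have "\<dots> = (\<Sum>i\<le>N. \<Sum>j\<le>N. \<Sum>k<M. a i * cnj (b j) * (cnj (u k) ^ i * cnj (u k) ^ j))"
      by (intro sum.cong refl sum.swap)
    also have "\<dots> = (\<Sum>i\<le>N. \<Sum>j\<le>N. a i * cnj (b j) * (if i = 0 \<and> j = 0 then of_nat M else 0))"
      using M unfolding pw2 sum_distrib_left[symmetric]
      by (intro sum.cong refl arg_cong2[where f = "(*)"], subst sum_cis_powers) auto
    also have "\<dots> = (\<Sum>i\<le>N. if i = 0 then of_nat M * (a 0 * cnj (b 0)) else 0)"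
      by (intro sum.cong refl) (auto simp: if_distrib[of "(*) _"] cong: if_cong)
    finally show ?thesis by simp
  qed
  have "of_real (2 * Re x) = x + cnj x" for x :: complex by (simp add: complex_add_cnj)
  then show ?thesis
    using 1 2 by (simp only: distrib_left sum.distrib)
qed

lemma holomorphic_sums_coef:
  assumes "f holomorphic_on ball 0 r" "z \<in> ball 0 r"
  shows "(\<lambda>n. coef f n * z ^ n) sums f z"
  using holomorphic_power_series[OF assms] by (simp add: coef_def)

lemma uniform_limit_coef:
  assumes hol: "f holomorphic_on ball 0 r" and s: "s < r"
  shows "uniform_limit (cball 0 s) (\<lambda>N z. \<Sum>i<N. coef f i * z ^ i) f sequentially"
proof (cases "0 \<le> s")
  case True
  have sub: "z \<in> ball 0 r" if "z \<in> cball 0 s" for z :: complex using that s by auto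
  have "summable (\<lambda>n. norm (coef f n) * s ^ n)"
  proof -
    obtain t where t: "s < t" "t < r" using s dense by blast
    have "summable (\<lambda>n. coef f n * of_real t ^ n)"
      using holomorphic_sums_coef[OF hol, of "of_real t"] t True sums_summable by force
    from powser_insidea[OF this, of "of_real s"] show ?thesis
      using t True by (simp add: norm_mult norm_power)
  qed
  then have "uniform_limit (cball 0 s) (\<lambda>N z. \<Sum>i<N. coef f i * z ^ i) (\<lambda>z. \<Sum>i. coef f i * z ^ i) sequentially"
    by (rule Weierstrass_m_test[rotated])
       (auto simp: norm_mult norm_power intro!: mult_left_mono power_mono)
  moreover have "(\<Sum>i. coef f i * z ^ i) = f z" if "z \<in> cball 0 s" for z
    using holomorphic_sums_coef[OF hol sub[OF that]] sums_unique by force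
  ultimately show ?thesis
    using uniform_limit_cong'[OF refl, of "cball 0 s" "\<lambda>z. \<Sum>i. coef f i * z ^ i" f] by blast
qed auto

text \<open>On the smaller closed disk the real part has a positive minimum, which uniform
  convergence preserves up to a small error. Positivity can thus be used on polynomials, to which
  the finite averages apply.\<close>

lemma eventually_Re_partial_sum_pos:
  assumes hol: "f holomorphic_on ball 0 r" and s: "0 \<le> s" "s < r"
    and pos: "\<And>z. z \<in> ball 0 r \<Longrightarrow> 0 < Re (f z)"
  shows "eventually (\<lambda>N. \<forall>z\<in>cball 0 s. 0 < Re (\<Sum>i\<le>N. coef f i * z ^ i)) sequentially"
proof -
  have sub: "z \<in> ball 0 r" if "z \<in> cball 0 s" for z :: complex using that s by auto
  have "continuous_on (cball 0 s) (\<lambda>z. Re (f z))"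
    by (intro continuous_intros holomorphic_on_imp_continuous_on holomorphic_on_subset[OF hol])
       (use sub in blast)
  then obtain m where m: "m \<in> cball 0 s" "\<And>z. z \<in> cball 0 s \<Longrightarrow> Re (f m) \<le> Re (f z)"
    using continuous_attains_inf[of "cball 0 s"] s by (metis centre_in_cball compact_cball empty_iff)
  have "0 < Re (f m)" using m sub pos by blast
  then have "eventually (\<lambda>N. \<forall>z\<in>cball 0 s. dist (\<Sum>i<N. coef f i * z ^ i) (f z) < Re (f m)) sequentially"
    using uniform_limit_coef[OF hol s(2)] by (auto simp: uniform_limit_iff)
  then have "eventually (\<lambda>N. \<forall>z\<in>cball 0 s. 0 < Re (\<Sum>i<N. coef f i * z ^ i)) sequentially"
  proof eventually_elim
    case (elim N)
    show ?case
    proof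
      fix z :: complex assume z: "z \<in> cball 0 s"
      have "Re (f z - (\<Sum>i<N. coef f i * z ^ i)) < Re (f m)"
        using elim[rule_format, OF z] complex_Re_le_cmod[of "f z - (\<Sum>i<N. coef f i * z ^ i)"]
        by (simp add: dist_norm norm_minus_commute)
      then show "0 < Re (\<Sum>i<N. coef f i * z ^ i)" using m(2)[OF z] by simp
    qed
  qed
  then have "eventually (\<lambda>N. \<forall>z\<in>cball 0 s. 0 < Re (\<Sum>i<Suc N. coef f i * z ^ i)) sequentially"
    by (rule eventually_compose_filterlim[OF _ filterlim_Suc])
  then show ?thesis by (simp only: lessThan_Suc_atMost)
qed

lemma coef_0: "coef f 0 = f 0"
  by (simp add: coef_def)

text \<open>The weights \<open>R k\<close>, twice the real part of a partial sum on the circle of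
  radius \<open>s\<close>, are nonnegative with mean 2. Their mean against
  \<open>cnj (u k) ^ n\<close> is \<open>coef p n * s ^ n\<close>, so the triangle inequality bounds
  it by 2; then \<open>s\<close> tends to 1.\<close>

lemma Caratheodory_coef_bound:
  assumes hol: "p holomorphic_on ball 0 1" and p0: "p 0 = 1"
    and pos: "\<And>z. z \<in> ball 0 1 \<Longrightarrow> 0 < Re (p z)" and n: "0 < n"
  shows "cmod (coef p n) \<le> 2"
proof -
  have le: "cmod (coef p n) * s ^ n \<le> 2" if s: "0 \<le> s" "s < 1" for s
  proof -
    have "eventually (\<lambda>N. n \<le> N \<and> (\<forall>z\<in>cball 0 s. 0 < Re (\<Sum>i\<le>N. coef p i * z ^ i))) sequentially"
      by (intro eventually_conj eventually_Re_partial_sum_pos[OF hol s pos] eventually_ge_at_top)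
    then obtain N where N: "n \<le> N" "\<And>z. z \<in> cball 0 s \<Longrightarrow> 0 < Re (\<Sum>i\<le>N. coef p i * z ^ i)"
      using eventually_happens' sequentially_bot by blast
    define M where "M = Suc (2 * N)"
    define u where "u = (\<lambda>k. cis (2 * pi / real M) ^ k)"
    define b where "b = (\<lambda>j. coef p j * of_real s ^ j)"
    define R where "R = (\<lambda>k. 2 * Re (\<Sum>j\<le>N. b j * u k ^ j))"
    have nu: "cmod (u k) = 1" for k by (simp add: u_def norm_power)
    have R: "0 \<le> R k" for k
      using N(2)[of "of_real s * u k"] s nu[of k]
      by (simp add: R_def b_def norm_mult power_mult_distrib mult_ac less_imp_le)
    have id: "(\<Sum>k<M. (\<Sum>i\<le>N. a i * cnj (u k) ^ i) * of_real (R k))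
      = of_nat M * ((\<Sum>j\<le>N. a j * b j) + a 0 * cnj (b 0))" for a
      unfolding R_def u_def by (rule sum_roots_unity_mult_Re) (simp add: M_def)
    have "(\<Sum>k<M. of_real (R k)) = of_nat M * (2 :: complex)"
      using id[of "\<lambda>i. if i = 0 then 1 else 0"]
      by (simp add: if_distrib[of "\<lambda>x. x * _"] b_def coef_0 p0 cong: if_cong)
    then have "complex_of_real (\<Sum>k<M. R k) = of_real (real M * 2)" by simp
    then have sumR: "(\<Sum>k<M. R k) = real M * 2" by (simp only: of_real_eq_iff)
    have "(\<Sum>k<M. cnj (u k) ^ n * of_real (R k)) = of_nat M * b n"
      using id[of "\<lambda>i. if i = n then 1 else 0"] N(1) n
      by (simp add: if_distrib[of "\<lambda>x. x * _"] cong: if_cong)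
    then have "real M * cmod (b n) = cmod (\<Sum>k<M. cnj (u k) ^ n * of_real (R k))"
      by (simp add: norm_mult)
    also have "\<dots> \<le> (\<Sum>k<M. cmod (cnj (u k) ^ n * of_real (R k)))" by (rule norm_sum)
    also have "\<dots> = real M * 2" using R by (simp add: norm_mult norm_power nu sumR)
    finally have "cmod (b n) \<le> 2"
      by (rule mult_left_le_imp_le) (simp add: M_def)
    then show ?thesis using s by (simp add: b_def norm_mult norm_power)
  qed
  show ?thesis
  proof (rule tendsto_upperbound)
    show "((\<lambda>s. cmod (coef p n) * s ^ n) \<longlongrightarrow> cmod (coef p n)) (at_left (1::real))"
      by (auto intro!: tendsto_eq_intros)
    show "eventually (\<lambda>s. cmod (coef p n) * s ^ n \<le> 2) (at_left (1::real))"
      by (rule eventually_mono[OF eventually_at_left_real[of 0 1]]) (auto intro: le)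
  qed auto
qed

lemma coef_unique:
  assumes r: "0 < r" and sums: "\<And>z. z \<in> ball 0 r \<Longrightarrow> (\<lambda>n. a n * z ^ n) sums f z"
  shows "coef f n = a n"
proof -
  have ev: "eventually (\<lambda>z. z \<in> ball 0 r) (nhds (0::complex))"
    using r by (intro eventually_nhds_in_open) auto
  have "summable (\<lambda>n. a n * of_real (r / 2) ^ n)"
    by (rule sums_summable[OF sums]) (use r in simp)
  from conv_radius_geI[OF this] have "ereal (norm (of_real (r / 2) :: complex)) \<le> conv_radius a" .
  moreover have "0 < norm (of_real (r / 2) :: complex)" using r by simp
  ultimately have "0 < conv_radius a" by (metis ereal_less(2) less_le_trans)
  then have "0 < fps_conv_radius (Abs_fps a)" by (simp add: fps_conv_radius_def)
  moreover have "eventually (\<lambda>z. eval_fps (Abs_fps a) z = f z) (nhds 0)"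
    using ev
  proof eventually_elim
    case (elim z)
    show ?case using sums_unique[OF sums[OF elim]] by (simp add: eval_fps_def)
  qed
  ultimately have "f has_fps_expansion Abs_fps a" by (simp add: has_fps_expansion_def)
  then show ?thesis using fps_nth_fps_expansion[of f "Abs_fps a" n] by (simp add: coef_def)
qed

lemma coef_deriv: "coef (deriv f) n = of_nat (Suc n) * coef f (Suc n)"
proof -
  have "(deriv ^^ Suc n) f = (deriv ^^ n) (deriv f)" by (metis comp_apply funpow_Suc_right)
  then show ?thesis by (simp add: coef_def fact_Suc field_simps del: of_nat_Suc funpow.simps)
qed

lemma coef_add_cmult:
  assumes "f holomorphic_on ball 0 r" "g holomorphic_on ball 0 r" "0 < r"
  shows "coef (\<lambda>z. f z + c * g z) n = coef f n + c * coef g n"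
proof (rule coef_unique[OF assms(3)])
  fix z :: complex assume z: "z \<in> ball 0 r"
  show "(\<lambda>n. (coef f n + c * coef g n) * z ^ n) sums (f z + c * g z)"
    using sums_add[OF holomorphic_sums_coef[OF assms(1) z]
        sums_mult[OF holomorphic_sums_coef[OF assms(2) z], of c]]
    by (simp add: distrib_right mult.assoc)
qed

section \<open>Growth, coefficients, covering and compactness\<close>

lemma classRH0_iff:
  "(h, g) \<in> classRH0 \<longleftrightarrow> h holomorphic_on ball 0 1 \<and> g holomorphic_on ball 0 1 \<and>
     h 0 = 0 \<and> g 0 = 0 \<and> deriv h 0 = 1 \<and> deriv g 0 = 0 \<and>
     (\<forall>z\<in>ball 0 1. cmod (deriv g z) < Re (deriv h z))"
  by (auto simp: classRH0_def classH_def unit_disk_def)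

text \<open>Supplies the rotation for which a triangle inequality becomes an equality:
  \<open>u = -1\<close> gives the least real part, and \<open>u\<close> along another number aligns
  the two.\<close>

lemma unit_rotation_exists:
  assumes "cmod u = 1"
  obtains \<epsilon> where "cmod \<epsilon> = 1" "\<epsilon> * b = of_real (cmod b) * u"
proof (cases "b = 0")
  case False
  then show ?thesis
    using that[of "of_real (cmod b) * u / b"] assms by (simp add: norm_divide norm_mult)
qed (use that[of 1] in auto)

lemma deriv_add_cmult:
  assumes "h holomorphic_on S" "g holomorphic_on S" "open S" "z \<in> S"
  shows "deriv (\<lambda>z. h z + c * g z) z = deriv h z + c * deriv g z"
  using assms by (intro DERIV_imp_deriv) (auto intro!: derivative_eq_intros holomorphic_derivI)

text \<open>The least value of \<open>Re (a + \<epsilon> * b)\<close> is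
  \<open>Re a - cmod b\<close>. This translates between the defining inequality of the class and
  functions of positive real part.\<close>

lemma Re_pos_rotations_iff:
  "(\<forall>\<epsilon>. cmod \<epsilon> = 1 \<longrightarrow> 0 < Re (a + \<epsilon> * b)) \<longleftrightarrow> cmod b < Re a"
proof
  assume *: "\<forall>\<epsilon>. cmod \<epsilon> = 1 \<longrightarrow> 0 < Re (a + \<epsilon> * b)"
  obtain \<epsilon> where "cmod \<epsilon> = 1" "\<epsilon> * b = of_real (cmod b) * (-1)"
    using unit_rotation_exists[of "-1"] by auto
  moreover from this * have "0 < Re (a + \<epsilon> * b)" by blast
  ultimately show "cmod b < Re a" by simp
next
  assume *: "cmod b < Re a"
  show "\<forall>\<epsilon>. cmod \<epsilon> = 1 \<longrightarrow> 0 < Re (a + \<epsilon> * b)"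
  proof safe
    fix \<epsilon> :: complex assume "cmod \<epsilon> = 1"
    then have "\<bar>Re (\<epsilon> * b)\<bar> \<le> cmod b" using abs_Re_le_cmod[of "\<epsilon> * b"] by (simp add: norm_mult)
    then show "0 < Re (a + \<epsilon> * b)" using * by simp
  qed
qed

lemma classRH0_Caratheodory:
  assumes hg: "(h, g) \<in> classRH0" and e: "cmod \<epsilon> = 1"
  shows "(\<lambda>z. deriv h z + \<epsilon> * deriv g z) holomorphic_on ball 0 1"
    and "deriv h 0 + \<epsilon> * deriv g 0 = 1"
    and "z \<in> ball 0 1 \<Longrightarrow> 0 < Re (deriv h z + \<epsilon> * deriv g z)"
proof -
  note hg' = hg[unfolded classRH0_iff]
  show "(\<lambda>z. deriv h z + \<epsilon> * deriv g z) holomorphic_on ball 0 1"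
    using hg' by (auto intro!: holomorphic_intros holomorphic_deriv)
  show "deriv h 0 + \<epsilon> * deriv g 0 = 1" using hg' by simp
  show "0 < Re (deriv h z + \<epsilon> * deriv g z)" if "z \<in> ball 0 1"
    using hg' e that Re_pos_rotations_iff[of "deriv h z" "deriv g z"] by blast
qed

lemma classRH0_eq_harm_analogue: "classRH0 = harm_analogue classR"
proof -
  have "(h, g) \<in> classRH0 \<longleftrightarrow> (h, g) \<in> harm_analogue classR" for h g
  proof
    assume hg: "(h, g) \<in> classRH0"
    note hg' = hg[unfolded classRH0_iff]
    have "(\<lambda>z. h z + \<epsilon> * g z) \<in> classR" if "cmod \<epsilon> = 1" for \<epsilon>
      using hg' classRH0_Caratheodory(3)[OF hg that]
      by (auto simp: classR_def classA_def unit_disk_def deriv_add_cmult[where S = "ball 0 1"]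
          intro!: holomorphic_intros)
    then show "(h, g) \<in> harm_analogue classR"
      using hg' by (auto simp: harm_analogue_def unit_disk_def)
  next
    assume "(h, g) \<in> harm_analogue classR"
    then have hol: "h holomorphic_on ball 0 1" "g holomorphic_on ball 0 1"
      and R: "\<And>\<epsilon>. cmod \<epsilon> = 1 \<Longrightarrow> (\<lambda>z. h z + \<epsilon> * g z) \<in> classR"
      by (auto simp: harm_analogue_def unit_disk_def)
    have d: "deriv (\<lambda>z. h z + \<epsilon> * g z) z = deriv h z + \<epsilon> * deriv g z" if "z \<in> ball 0 1" for \<epsilon> z
      by (rule deriv_add_cmult[OF hol open_ball that])
    \<comment> \<open>The two rotations 1 and -1 suffice to separate the normalisation of
      \<open>h\<close> from that of \<open>g\<close>.\<close>
    have "h 0 + 1 * g 0 = 0" "h 0 + (-1) * g 0 = 0"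
      using R[of 1] R[of "-1"] by (auto simp: classR_def classA_def)
    then have 0: "h 0 = 0" "g 0 = 0" by (auto simp: algebra_simps)
    have "deriv h 0 + 1 * deriv g 0 = 1" "deriv h 0 + (-1) * deriv g 0 = 1"
      using R[of 1] R[of "-1"] d[of 0 1] d[of 0 "-1"] by (auto simp: classR_def classA_def)
    then have 1: "deriv h 0 = 1" "deriv g 0 = 0" by (auto simp: algebra_simps)
    have "cmod (deriv g z) < Re (deriv h z)" if "z \<in> ball 0 1" for z
      unfolding Re_pos_rotations_iff[symmetric]
    proof (intro allI impI)
      fix \<epsilon> :: complex assume "cmod \<epsilon> = 1"
      then have "0 < Re (deriv (\<lambda>z. h z + \<epsilon> * g z) z)"
        using R that by (auto simp: classR_def unit_disk_def)
      then show "0 < Re (deriv h z + \<epsilon> * deriv g z)" by (simp only: d[OF that])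
    qed
    then show "(h, g) \<in> classRH0" using 0 1 hol by (simp add: classRH0_iff)
  qed
  then show ?thesis by auto
qed

lemma classRH0_bounds:
  assumes hg: "(h, g) \<in> classRH0" and z: "z \<in> ball 0 1"
  shows "(1 - cmod z) / (1 + cmod z) \<le> Re (deriv h z) - cmod (deriv g z)"
    and "cmod (deriv h z) + cmod (deriv g z) \<le> (1 + cmod z) / (1 - cmod z)"
proof -
  obtain \<epsilon> where e: "cmod \<epsilon> = 1" "\<epsilon> * deriv g z = of_real (cmod (deriv g z)) * (-1)"
    using unit_rotation_exists[of "-1"] by auto
  show "(1 - cmod z) / (1 + cmod z) \<le> Re (deriv h z) - cmod (deriv g z)"
    using Caratheodory_Harnack(1)[OF classRH0_Caratheodory[OF hg e(1)] z] e(2) by simp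
next
  \<comment> \<open>The value 1 is a default for a vanishing derivative, where \<open>sgn\<close> is
    not unimodular.\<close>
  define u where "u = (if deriv h z = 0 then 1 else sgn (deriv h z))"
  have u: "cmod u = 1" "deriv h z = of_real (cmod (deriv h z)) * u"
    by (simp_all add: u_def norm_sgn, simp add: sgn_eq)
  obtain \<epsilon> where e: "cmod \<epsilon> = 1" "\<epsilon> * deriv g z = of_real (cmod (deriv g z)) * u"
    using unit_rotation_exists[OF u(1)] by auto
  have "deriv h z + \<epsilon> * deriv g z = of_real (cmod (deriv h z) + cmod (deriv g z)) * u"
    using u(2) e(2) by (metis distrib_right of_real_add)
  then have "cmod (deriv h z + \<epsilon> * deriv g z) = cmod (deriv h z) + cmod (deriv g z)"
    by (simp only: norm_mult norm_of_real u(1)) auto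
  then show "cmod (deriv h z) + cmod (deriv g z) \<le> (1 + cmod z) / (1 - cmod z)"
    using Caratheodory_Harnack(2)[OF classRH0_Caratheodory[OF hg e(1)] z] by simp
qed

section \<open>Monotonicity and close-to-convexity of the harmonic maps\<close>

lemma harmonic_has_derivative_line:
  assumes hol: "h holomorphic_on S" "g holomorphic_on S" and S: "open S" "a + of_real t * u \<in> S"
  shows "((\<lambda>t. Re (v * (h (a + of_real t * u) + c * cnj (g (a + of_real t * u))))) has_real_derivative
    Re (v * (deriv h (a + of_real t * u) * u + c * cnj (deriv g (a + of_real t * u) * u)))) (at t)"
proof -
  have line: "((\<lambda>x. a + of_real x * u) has_vector_derivative u) (at t)"
    by (auto intro!: derivative_eq_intros has_vector_derivative_of_real simp: has_vector_derivative_def scaleR_conv_of_real)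
  have d: "((\<lambda>x. f (a + of_real x * u)) has_vector_derivative (deriv f (a + of_real t * u) * u)) (at t)"
    if "f holomorphic_on S" for f
    using field_vector_diff_chain_at[OF line holomorphic_derivI[OF that S]]
    by (simp add: o_def mult.commute)
  have "((\<lambda>t. v * (h (a + of_real t * u) + c * cnj (g (a + of_real t * u)))) has_vector_derivative
    (v * (deriv h (a + of_real t * u) * u + c * cnj (deriv g (a + of_real t * u) * u)))) (at t)"
    by (intro has_vector_derivative_mult_right has_vector_derivative_add has_vector_derivative_cnj d hol)
  then show ?thesis
    unfolding has_real_derivative_iff_has_vector_derivative
    by (rule bounded_linear.has_vector_derivative[OF bounded_linear_Re])
qed

text \<open>The analytic part contributes exactly \<open>Re a * (cmod u)\<^sup>2\<close>, and the
  conjugate part has modulus \<open>cmod b * (cmod u)\<^sup>2\<close>. This infinitesimal estimate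
  drives both strict monotonicity and the lower growth bound.\<close>

lemma Re_harmonic_derivative_ge:
  assumes "cmod c = 1"
  shows "(Re a - cmod b) * (cmod u)\<^sup>2 \<le> Re (cnj u * (a * u + c * cnj (b * u)))"
proof -
  have "Re (cnj u * (a * u)) = Re a * (cmod u)\<^sup>2"
    unfolding cmod_power2 by (simp add: algebra_simps power2_eq_square)
  moreover have "cmod (cnj u * (c * cnj (b * u))) = cmod b * (cmod u)\<^sup>2"
    using assms by (simp add: norm_mult power2_eq_square)
  then have "- (cmod b * (cmod u)\<^sup>2) \<le> Re (cnj u * (c * cnj (b * u)))"
    by (metis abs_Re_le_cmod abs_le_D2 minus_le_iff)
  ultimately show ?thesis by (simp add: algebra_simps)
qed

text \<open>The Noshiro--Warschawski argument: along the segment from \<open>w\<close> to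
  \<open>z\<close> the component of the map in the direction \<open>z - w\<close> has positive
  derivative.\<close>

lemma classRH0_strictly_monotone:
  assumes hg: "(h, g) \<in> classRH0" and c: "cmod c = 1" and S: "convex S" "S \<subseteq> ball 0 1"
  shows "strictly_monotone_on S (\<lambda>z. h z + c * cnj (g z))"
  unfolding strictly_monotone_on_def
proof (intro ballI impI)
  fix z w assume zw: "z \<in> S" "w \<in> S" "z \<noteq> w"
  note hg' = hg[unfolded classRH0_iff]
  define u where "u = z - w"
  define k where "k = (\<lambda>t. Re (cnj u * (h (w + of_real t * u) + c * cnj (g (w + of_real t * u)))))"
  define k' where "k' = (\<lambda>t. Re (cnj u * (deriv h (w + of_real t * u) * u
    + c * cnj (deriv g (w + of_real t * u) * u))))"
  have mem: "w + of_real t * u \<in> ball 0 1" if "0 \<le> t" "t \<le> 1" for t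
  proof -
    have "w + of_real t * u = (1 - t) *\<^sub>R w + t *\<^sub>R z"
      by (simp add: u_def scaleR_conv_of_real algebra_simps)
    then have "w + of_real t * u \<in> S" using convexD_alt[OF S(1) zw(2,1) that] by simp
    then show ?thesis using S(2) by blast
  qed
  have "k 0 < k 1"
  proof (rule DERIV_pos_imp_increasing[of 0 1 k])
    fix t :: real assume t: "0 \<le> t" "t \<le> 1"
    have "(k has_real_derivative k' t) (at t)"
      unfolding k_def k'_def using harmonic_has_derivative_line hg' mem[OF t] open_ball by blast
    moreover have "0 < (Re (deriv h (w + of_real t * u)) - cmod (deriv g (w + of_real t * u))) * (cmod u)\<^sup>2"
      using hg' mem[OF t] zw(3) by (auto simp: u_def)
    then have "0 < k' t"
      unfolding k'_def using Re_harmonic_derivative_ge[OF c] by (rule less_le_trans)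
    ultimately show "\<exists>y. (k has_real_derivative y) (at t) \<and> 0 < y" by blast
  qed simp
  then have "0 < Re (cnj u * ((h z + c * cnj (g z)) - (h w + c * cnj (g w))))"
    by (simp add: k_def u_def algebra_simps)
  then show "0 < ((h z + c * cnj (g z)) - (h w + c * cnj (g w))) \<bullet> (z - w)"
    by (simp add: inner_complex_def u_def algebra_simps)
qed

lemma classRH0_continuous:
  assumes "(h, g) \<in> classRH0" "S \<subseteq> ball 0 1"
  shows "continuous_on S (\<lambda>z. h z + c * cnj (g z))"
  using assms unfolding classRH0_iff
  by (intro continuous_intros) (auto intro: holomorphic_on_imp_continuous_on holomorphic_on_subset)

lemma classRH0_close_to_convex:
  assumes "(h, g) \<in> classRH0" "cmod c = 1" "0 < r" "r \<le> 1"
  shows "inj_on (\<lambda>z. h z + c * cnj (g z)) (ball 0 r)"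
    and "close_to_convex_domain ((\<lambda>z. h z + c * cnj (g z)) ` ball 0 r)"
proof -
  have sub: "ball (0::complex) r \<subseteq> ball 0 1" using assms(4) by auto
  note mono = classRH0_strictly_monotone[OF assms(1,2) convex_ball sub]
  show "inj_on (\<lambda>z. h z + c * cnj (g z)) (ball 0 r)"
    by (rule strictly_monotone_on_imp_inj_on[OF mono])
  show "close_to_convex_domain ((\<lambda>z. h z + c * cnj (g z)) ` ball 0 r)"
    by (rule close_to_convex_domain_strictly_monotone[OF assms(3) classRH0_continuous[OF assms(1) sub] mono])
qed

lemma harm_eq: "harm (h, g) = (\<lambda>z. h z + 1 * cnj (g z))"
  by (simp add: harm_def)

lemma classRH0_subset_classSCH0: "classRH0 \<subseteq> classSCH0"
proof clarify
  fix h g assume hg: "(h, g) \<in> classRH0"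
  note hg' = hg[unfolded classRH0_iff]
  have "cmod (deriv g z) < cmod (deriv h z)" if "z \<in> ball 0 1" for z
    using hg' that complex_Re_le_cmod[of "deriv h z"] by (meson less_le_trans)
  moreover have "(h, g) \<in> classH" using hg by (simp add: classRH0_def)
  ultimately show "(h, g) \<in> classSCH0"
    using classRH0_close_to_convex[OF hg, of _ 1] classRH0_close_to_convex[OF hg, of 1 1]
    by (auto simp: classSCH0_def unit_disk_def harm_eq)
qed

lemma radius_ctc_classRH0: "radius_ctc (harm ` classRH0) = 1"
proof -
  have "inj_on (harm p) (ball 0 1) \<and> close_to_convex_domain (harm p ` ball 0 1)" if "p \<in> classRH0" for p
    using classRH0_close_to_convex[of "fst p" "snd p" 1 1] that
    by (simp add: harm_eq[of "fst p" "snd p", simplified])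
  then show ?thesis
    unfolding radius_ctc_def by (intro cSup_eq_maximum) auto
qed

section \<open>Coefficient, growth and covering estimates\<close>

text \<open>The rotation \<open>\<epsilon> = 1\<close> suffices: the coefficient of
  \<open>deriv h + deriv g\<close> of index \<open>n - 1\<close> is \<open>n\<close> times
  \<open>coef h n + coef g n\<close>, and the reverse triangle inequality gives the difference of
  moduli.\<close>

lemma classRH0_coef_bound:
  assumes hg: "(h, g) \<in> classRH0" and n: "2 \<le> n"
  shows "\<bar>cmod (coef h n) - cmod (coef g n)\<bar> \<le> 2 / real n"
proof -
  note hg' = hg[unfolded classRH0_iff]
  obtain m where m: "n = Suc m" "0 < m" using n by (cases n) auto
  have "coef (\<lambda>z. deriv h z + 1 * deriv g z) m = coef (deriv h) m + 1 * coef (deriv g) m"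
    using hg' by (intro coef_add_cmult[of _ 1] holomorphic_deriv) auto
  also have "\<dots> = of_nat n * (coef h n + coef g n)"
    by (simp only: coef_deriv m(1)[symmetric]) (simp add: algebra_simps)
  finally have eq: "coef (\<lambda>z. deriv h z + 1 * deriv g z) m = of_nat n * (coef h n + coef g n)" .
  have "cmod (of_nat n * (coef h n + coef g n)) \<le> 2"
    unfolding eq[symmetric]
    by (rule Caratheodory_coef_bound[OF _ _ _ m(2)]) (use classRH0_Caratheodory[OF hg, of 1] in auto)
  then have "real n * cmod (coef h n + coef g n) \<le> 2" by (simp add: norm_mult)
  then have "cmod (coef h n + coef g n) \<le> 2 / real n" using n by (simp add: field_simps)
  moreover have "\<bar>cmod (coef h n) - cmod (coef g n)\<bar> \<le> cmod (coef h n + coef g n)"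
    using norm_triangle_ineq3[of "coef h n" "- coef g n"] by simp
  ultimately show ?thesis by linarith
qed

text \<open>The comparison function has derivative \<open>(1 - s) / (1 + s)\<close>, the lower bound
  of \<open>Re (deriv h z) - cmod (deriv g z)\<close>. The component along \<open>u\<close>, rather
  than the modulus, is estimated because the covering argument needs it.\<close>

lemma classRH0_radial_lower_bound:
  assumes hg: "(h, g) \<in> classRH0" and u: "cmod u = 1" and s: "0 \<le> s" "s < 1"
  shows "- s + 2 * ln (1 + s) \<le> Re (cnj u * (h (of_real s * u) + cnj (g (of_real s * u))))"
proof -
  note hg' = hg[unfolded classRH0_iff]
  define k where "k = (\<lambda>t. Re (cnj u * (h (0 + of_real t * u) + 1 * cnj (g (0 + of_real t * u)))) - (- t + 2 * ln (1 + t)))"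
  have "k 0 \<le> k s"
  proof (rule DERIV_nonneg_imp_nondecreasing[OF s(1)])
    fix t assume t: "0 \<le> t" "t \<le> s"
    let ?z = "0 + of_real t * u"
    have z: "?z \<in> ball 0 1" "cmod ?z = t" using t s u by (auto simp: norm_mult)
    have "(k has_real_derivative Re (cnj u * (deriv h ?z * u + 1 * cnj (deriv g ?z * u))) - (-1 + 2 * (1 / (1 + t)))) (at t)"
      unfolding k_def using hg' t
      by (intro DERIV_diff harmonic_has_derivative_line[OF _ _ open_ball z(1)])
         (auto intro!: derivative_eq_intros)
    moreover have "-1 + 2 * (1 / (1 + t)) = (1 - cmod ?z) / (1 + cmod ?z)"
      using t unfolding z(2) by (simp add: field_simps)
    then have "-1 + 2 * (1 / (1 + t)) \<le> (Re (deriv h ?z) - cmod (deriv g ?z)) * (cmod u)\<^sup>2"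
      using classRH0_bounds(1)[OF hg z(1)] u by simp
    then have "-1 + 2 * (1 / (1 + t)) \<le> Re (cnj u * (deriv h ?z * u + 1 * cnj (deriv g ?z * u)))"
      using Re_harmonic_derivative_ge[of 1 "deriv h ?z" "deriv g ?z" u] by simp
    ultimately show "\<exists>y. (k has_real_derivative y) (at t) \<and> 0 \<le> y" by fastforce
  qed
  then show ?thesis using hg' by (simp add: k_def)
qed

lemma classRH0_radial_upper_bound:
  assumes hg: "(h, g) \<in> classRH0" and u: "cmod u = 1" and s: "0 \<le> s" "s < 1"
  shows "cmod (h (of_real s * u) + cnj (g (of_real s * u))) \<le> - s - 2 * ln (1 - s)"
proof -
  note hg' = hg[unfolded classRH0_iff]
  define w where "w = h (of_real s * u) + cnj (g (of_real s * u))"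
  \<comment> \<open>A fixed factor that turns the value at the end of the radius into its modulus;
    it is 0 when that value is 0, hence only \<open>cmod v \<le> 1\<close>.\<close>
  define v where "v = cnj (sgn w)"
  have "v * w = (w * cnj w) / of_real (cmod w)" by (simp add: v_def sgn_eq)
  also have "\<dots> = of_real (cmod w)"
    unfolding complex_norm_square[symmetric] by (simp add: power2_eq_square)
  finally have v: "Re (v * w) = cmod w" "cmod v \<le> 1" by (simp_all add: v_def norm_sgn)
  define k where "k = (\<lambda>t. (- t - 2 * ln (1 - t)) - Re (v * (h (0 + of_real t * u) + 1 * cnj (g (0 + of_real t * u)))))"
  have "k 0 \<le> k s"
  proof (rule DERIV_nonneg_imp_nondecreasing[OF s(1)])
    fix t assume t: "0 \<le> t" "t \<le> s"
    let ?z = "0 + of_real t * u"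
    have z: "?z \<in> ball 0 1" "cmod ?z = t" using t s u by (auto simp: norm_mult)
    have "(k has_real_derivative (-1 + 2 * (1 / (1 - t))) - Re (v * (deriv h ?z * u + 1 * cnj (deriv g ?z * u)))) (at t)"
      unfolding k_def using hg' t s
      by (intro DERIV_diff harmonic_has_derivative_line[OF _ _ open_ball z(1)])
         (auto intro!: derivative_eq_intros)
    moreover have "-1 + 2 * (1 / (1 - t)) = (1 + cmod ?z) / (1 - cmod ?z)"
      using t s unfolding z(2) by (simp add: field_simps)
    moreover have "Re (v * (deriv h ?z * u + 1 * cnj (deriv g ?z * u)))
        \<le> cmod v * cmod (deriv h ?z * u + 1 * cnj (deriv g ?z * u))"
      using complex_Re_le_cmod norm_mult by metis
    moreover have "\<dots> \<le> 1 * cmod (deriv h ?z * u + 1 * cnj (deriv g ?z * u))"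
      using v by (intro mult_right_mono) auto
    moreover have "cmod (deriv h ?z * u + 1 * cnj (deriv g ?z * u)) \<le> cmod (deriv h ?z) + cmod (deriv g ?z)"
      using norm_triangle_ineq[of "deriv h ?z * u" "1 * cnj (deriv g ?z * u)"] u by (simp add: norm_mult)
    ultimately show "\<exists>y. (k has_real_derivative y) (at t) \<and> 0 \<le> y"
      using classRH0_bounds(2)[OF hg z(1)] by (smt (verit))
  qed
  then show ?thesis using hg' v(1) by (simp add: k_def w_def)
qed

lemma polar_form:
  obtains u where "cmod u = 1" "z = of_real (cmod z) * u"
proof (cases "z = 0")
  case False
  then have 1: "of_real (cmod z) * (z / of_real (cmod z)) = z" by simp
  have 2: "cmod (z / of_real (cmod z)) = 1" using False by (simp add: norm_divide)
  show ?thesis using 2 1[symmetric] by (rule that)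
next
  case True
  show ?thesis by (rule that[of 1]) (simp_all add: True)
qed

lemma classRH0_growth:
  assumes hg: "(h, g) \<in> classRH0" and z: "z \<in> ball 0 1"
  shows "- cmod z + 2 * ln (1 + cmod z) \<le> cmod (h z + cnj (g z))"
    and "cmod (h z + cnj (g z)) \<le> - cmod z - 2 * ln (1 - cmod z)"
proof -
  obtain u where u: "cmod u = 1" "z = of_real (cmod z) * u" using polar_form .
  have r: "0 \<le> cmod z" "cmod z < 1" using z by auto
  have "- cmod z + 2 * ln (1 + cmod z) \<le> Re (cnj u * (h z + cnj (g z)))"
    using classRH0_radial_lower_bound[OF hg u(1) r] u(2) by simp
  also have "\<dots> \<le> cmod (h z + cnj (g z))"
    using complex_Re_le_cmod[of "cnj u * (h z + cnj (g z))"] u(1) by (simp add: norm_mult)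
  finally show "- cmod z + 2 * ln (1 + cmod z) \<le> cmod (h z + cnj (g z))" .
  show "cmod (h z + cnj (g z)) \<le> - cmod z - 2 * ln (1 - cmod z)"
    using classRH0_radial_upper_bound[OF hg u(1) r] u(2) by simp
qed

text \<open>Every \<open>y\<close> is a value of the monotone extension at some \<open>x\<close>. If
  \<open>cmod x = 1\<close>, testing at the points \<open>s * x\<close> bounds the radial component
  of the map there by \<open>cmod y\<close>; with \<open>s\<close> tending to 1 this puts
  \<open>y\<close> outside the disk.\<close>

lemma classRH0_covering:
  assumes hg: "(h, g) \<in> classRH0"
  shows "ball 0 (2 * ln 2 - 1) \<subseteq> harm (h, g) ` ball 0 1"
proof
  fix y :: complex assume y: "y \<in> ball 0 (2 * ln 2 - 1)"
  let ?f = "harm (h, g)"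
  have cont: "continuous_on (ball 0 1) ?f"
    unfolding harm_eq by (rule classRH0_continuous[OF hg]) simp
  have mono: "strictly_monotone_on (ball 0 1) ?f"
    unfolding harm_eq by (rule classRH0_strictly_monotone[OF hg]) auto
  obtain x where x: "x \<in> cball 0 1" "y \<in> monotone_ext (ball 0 1) ?f x"
    using monotone_ext_surj[OF _ cont mono] by auto
  show "y \<in> ?f ` ball 0 1"
  proof (cases "x \<in> ball 0 1")
    case True
    then show ?thesis using monotone_ext_interior[OF open_ball cont _ x(2)] by blast
  next
    case False
    then have nx: "cmod x = 1" using x by auto
    have le: "- s + 2 * ln (1 + s) \<le> cmod y" if s: "0 \<le> s" "s < 1" for s
    proof -
      have "0 \<le> (?f (of_real s * x) - y) \<bullet> (of_real s * x - x)"
        using x(2) s nx by (auto simp: monotone_ext_def norm_mult)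
      also have "of_real s * x - x = - ((1 - s) *\<^sub>R x)"
        by (simp add: scaleR_conv_of_real algebra_simps)
      finally have "0 \<le> - ((1 - s) * ((?f (of_real s * x) - y) \<bullet> x))" by simp
      then have "?f (of_real s * x) \<bullet> x \<le> y \<bullet> x"
        using s by (simp add: mult_le_0_iff inner_diff_left)
      moreover have "?f (of_real s * x) \<bullet> x = Re (cnj x * ?f (of_real s * x))"
        by (simp add: inner_complex_def mult.commute)
      moreover have "y \<bullet> x \<le> cmod y" using norm_cauchy_schwarz[of y x] nx by simp
      ultimately show ?thesis
        using classRH0_radial_lower_bound[OF hg nx s] by (simp add: harm_def)
    qed
    have "((\<lambda>s. - s + 2 * ln (1 + s)) \<longlongrightarrow> - 1 + 2 * ln (1 + 1)) (at_left (1::real))"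
      by (intro tendsto_intros) auto
    moreover have "eventually (\<lambda>s. - s + 2 * ln (1 + s) \<le> cmod y) (at_left (1::real))"
      by (rule eventually_mono[OF eventually_at_left_real[OF zero_less_one]]) (rule le, auto)
    ultimately have "- 1 + 2 * ln (1 + 1) \<le> cmod y" by (rule tendsto_upperbound) auto
    then show ?thesis using y by simp
  qed
qed

section \<open>Convex combinations and compactness\<close>

lemma classRH0_convex_combination:
  fixes N :: nat
  assumes hg: "\<And>i. i < N \<Longrightarrow> (hs i, gs i) \<in> classRH0" "\<And>i. i < N \<Longrightarrow> 0 \<le> t i"
    and t: "(\<Sum>i<N. t i) = (1::real)"
  shows "((\<lambda>z. \<Sum>i<N. complex_of_real (t i) * hs i z), (\<lambda>z. \<Sum>i<N. complex_of_real (t i) * gs i z)) \<in> classRH0"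
proof -
  note hg' = hg(1)[unfolded classRH0_iff]
  have dh: "deriv (\<lambda>z. \<Sum>i<N. complex_of_real (t i) * hs i z) z = (\<Sum>i<N. complex_of_real (t i) * deriv (hs i) z)"
    and dg: "deriv (\<lambda>z. \<Sum>i<N. complex_of_real (t i) * gs i z) z = (\<Sum>i<N. complex_of_real (t i) * deriv (gs i) z)"
    if z: "z \<in> ball 0 1" for z
  proof -
    have "(hs i has_field_derivative deriv (hs i) z) (at z)" "(gs i has_field_derivative deriv (gs i) z) (at z)"
      if "i < N" for i using hg'[OF that] z by (auto intro!: holomorphic_derivI[where S = "ball 0 1"])
    then show "deriv (\<lambda>z. \<Sum>i<N. complex_of_real (t i) * hs i z) z = (\<Sum>i<N. complex_of_real (t i) * deriv (hs i) z)"
      "deriv (\<lambda>z. \<Sum>i<N. complex_of_real (t i) * gs i z) z = (\<Sum>i<N. complex_of_real (t i) * deriv (gs i) z)"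
      by (auto intro!: DERIV_imp_deriv DERIV_sum DERIV_cmult)
  qed
  have lt: "cmod (\<Sum>i<N. complex_of_real (t i) * deriv (gs i) z) < Re (\<Sum>i<N. complex_of_real (t i) * deriv (hs i) z)"
    if z: "z \<in> ball 0 1" for z
  proof -
    \<comment> \<open>Weights may vanish, so strictness comes from one positive weight, which exists
      because they sum to 1.\<close>
    have "\<exists>i<N. t i \<noteq> 0" using t by (metis lessThan_iff sum.neutral zero_neq_one)
    then obtain j where j: "j < N" "0 < t j" using hg(2) by (metis less_eq_real_def)
    have "cmod (\<Sum>i<N. complex_of_real (t i) * deriv (gs i) z) \<le> (\<Sum>i<N. t i * cmod (deriv (gs i) z))"
      using hg(2) by (intro sum_norm_le) (simp add: norm_mult)
    also have "\<dots> < (\<Sum>i<N. t i * Re (deriv (hs i) z))"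
    proof (rule sum_strict_mono_ex1)
      have "cmod (deriv (gs i) z) < Re (deriv (hs i) z)" if "i < N" for i
        using hg'[OF that] z by blast
      then show "\<forall>i\<in>{..<N}. t i * cmod (deriv (gs i) z) \<le> t i * Re (deriv (hs i) z)"
        "\<exists>i\<in>{..<N}. t i * cmod (deriv (gs i) z) < t i * Re (deriv (hs i) z)"
        using hg(2) j by (auto intro!: mult_left_mono bexI[of _ j] simp: less_imp_le)
    qed auto
    finally show ?thesis by simp
  qed
  have d0: "(\<Sum>i<N. complex_of_real (t i) * deriv (hs i) 0) = of_real (\<Sum>i<N. t i)"
    using hg' by simp
  show ?thesis
    unfolding classRH0_iff
  proof (intro conjI ballI)
    show "cmod (deriv (\<lambda>z. \<Sum>i<N. complex_of_real (t i) * gs i z) z)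
        < Re (deriv (\<lambda>z. \<Sum>i<N. complex_of_real (t i) * hs i z) z)" if "z \<in> ball 0 1" for z
      unfolding dh[OF that] dg[OF that] by (rule lt[OF that])
  qed (use hg' t d0 in \<open>auto simp: dh dg intro!: holomorphic_intros\<close>)
qed

lemma uniform_limit_deriv_tendsto:
  assumes hol: "\<And>n. f n holomorphic_on S" and S: "open S" "z \<in> S"
    and lim: "\<And>K. compact K \<Longrightarrow> K \<subseteq> S \<Longrightarrow> uniform_limit K f g sequentially"
    and g: "g holomorphic_on S"
  shows "(\<lambda>n. deriv (f n) z) \<longlonglongrightarrow> deriv g z"
proof -
  have "\<exists>g'. \<forall>x\<in>S. (g has_field_derivative g' x) (at x) \<and> ((\<lambda>n. deriv (f n) x) \<longlongrightarrow> g' x) sequentially"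
  proof (rule has_complex_derivative_uniform_sequence[OF S(1)])
    show "(f n has_field_derivative deriv (f n) x) (at x)" if "x \<in> S" for n x
      using hol[of n] S(1) that by (rule holomorphic_derivI)
    show "\<exists>d>0. cball x d \<subseteq> S \<and> uniform_limit (cball x d) f g sequentially" if "x \<in> S" for x
      using S(1) that lim by (meson compact_cball open_contains_cball)
  qed
  then show ?thesis using S(2) DERIV_imp_deriv by metis
qed

text \<open>A crude mean value estimate, meant for Montel's theorem. It treats \<open>h\<close> and
  \<open>g\<close> separately since a bound on their harmonic combination does not directly bound
  either.\<close>

lemma classRH0_coordinate_bound:
  assumes hg: "(h, g) \<in> classRH0" and z: "z \<in> ball 0 1"
  shows "cmod (h z) \<le> (1 + cmod z) / (1 - cmod z)" "cmod (g z) \<le> (1 + cmod z) / (1 - cmod z)"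
proof -
  note hg' = hg[unfolded classRH0_iff]
  define R where "R = cmod z"
  have R: "0 \<le> R" "R < 1" using z by (auto simp: R_def)
  have B: "cmod (deriv h w) \<le> (1 + R) / (1 - R)" "cmod (deriv g w) \<le> (1 + R) / (1 - R)"
    if w: "w \<in> cball 0 R" for w
  proof -
    have w1: "w \<in> ball 0 1" "cmod w \<le> R" using w R by auto
    then have "(1 + cmod w) / (1 - cmod w) \<le> (1 + R) / (1 - R)"
      using R by (intro frac_le) auto
    then show "cmod (deriv h w) \<le> (1 + R) / (1 - R)" "cmod (deriv g w) \<le> (1 + R) / (1 - R)"
      using classRH0_bounds(2)[OF hg w1(1)] norm_ge_zero[of "deriv h w"] norm_ge_zero[of "deriv g w"]
      by linarith+
  qed
  have main: "cmod (f z) \<le> (1 + R) / (1 - R)"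
    if f: "f holomorphic_on ball 0 1" "f 0 = 0" "\<And>w. w \<in> cball 0 R \<Longrightarrow> cmod (deriv f w) \<le> (1 + R) / (1 - R)" for f
  proof -
    have "cmod (f z - f 0) \<le> (1 + R) / (1 - R) * cmod (z - 0)"
    proof (rule field_differentiable_bound[of "cball 0 R"])
      show "(f has_field_derivative deriv f w) (at w within cball 0 R)" if "w \<in> cball 0 R" for w
        by (rule holomorphic_derivI[OF f(1) open_ball]) (use that R in simp)
      show "z \<in> cball 0 R" "(0::complex) \<in> cball 0 R" using R(1) by (simp_all add: R_def)
    qed (simp, rule f(3))
    also have "\<dots> \<le> (1 + R) / (1 - R) * 1" using R z by (intro mult_left_mono) auto
    finally show ?thesis using f(2) by simp
  qed
  show "cmod (h z) \<le> (1 + cmod z) / (1 - cmod z)" "cmod (g z) \<le> (1 + cmod z) / (1 - cmod z)"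
    unfolding R_def[symmetric] using hg' B by (blast intro: main)+
qed

text \<open>Montel is applied to the \<open>hs\<close> and then, along the subsequence found, to the
  \<open>gs\<close>. Normalisations and weak inequalities pass to the limit; each rotation has value
  1 at 0, so strictness is regained from the open mapping theorem.\<close>

lemma classRH0_compact:
  fixes hs gs :: "nat \<Rightarrow> complex \<Rightarrow> complex"
  assumes hg: "\<And>n. (hs n, gs n) \<in> classRH0"
  obtains r h g where "strict_mono r" "(h, g) \<in> classRH0"
    "\<And>K. compact K \<Longrightarrow> K \<subseteq> ball 0 1 \<Longrightarrow> uniform_limit K (\<lambda>n. harm (hs (r n), gs (r n))) (harm (h, g)) sequentially"
proof -
  note hg' = hg[unfolded classRH0_iff]
  have bdd: "\<exists>B. \<forall>f\<in>F. \<forall>z\<in>K. cmod (f z) \<le> B"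
    if K: "compact K" "K \<subseteq> ball 0 1" and F: "\<And>f z. f \<in> F \<Longrightarrow> z \<in> ball 0 1 \<Longrightarrow> cmod (f z) \<le> (1 + cmod z) / (1 - cmod z)"
    for K :: "complex set" and F
  proof -
    have "bounded ((\<lambda>z. (1 + cmod z) / (1 - cmod z)) ` K)"
      using K by (intro compact_imp_bounded compact_continuous_image continuous_intros) auto
    then obtain B where "\<And>z. z \<in> K \<Longrightarrow> \<bar>(1 + cmod z) / (1 - cmod z)\<bar> \<le> B"
      unfolding bounded_iff by auto
    then have "\<forall>f\<in>F. \<forall>z\<in>K. cmod (f z) \<le> B" using F K(2) by (meson abs_le_D1 order_trans subsetD)
    then show ?thesis by blast
  qed
  have bh: "\<exists>B. \<forall>f\<in>range hs. \<forall>z\<in>K. cmod (f z) \<le> B"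
    and bg: "\<exists>B. \<forall>f\<in>range gs. \<forall>z\<in>K. cmod (f z) \<le> B"
    if "compact K" "K \<subseteq> ball 0 1" for K
    by (rule bdd[OF that]; use classRH0_coordinate_bound[OF hg] in auto)+
  obtain h r1 where h: "h holomorphic_on ball 0 1" "strict_mono r1"
      "\<And>K. compact K \<Longrightarrow> K \<subseteq> ball 0 1 \<Longrightarrow> uniform_limit K (hs \<circ> r1) h sequentially"
    by (rule Montel[of "ball 0 1" "range hs" hs, OF open_ball _ bh]) (use hg' in auto)
  obtain g r2 where g: "g holomorphic_on ball 0 1" "strict_mono r2"
      "\<And>K. compact K \<Longrightarrow> K \<subseteq> ball 0 1 \<Longrightarrow> uniform_limit K (gs \<circ> r1 \<circ> r2) g sequentially"
    by (rule Montel[of "ball 0 1" "range gs" "gs \<circ> r1", OF open_ball _ bg]) (use hg' in auto)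
  define r where "r = r1 \<circ> r2"
  have r: "strict_mono r" unfolding r_def using h(2) g(2) by (rule strict_mono_o)
  have hlim: "uniform_limit K (\<lambda>n. hs (r n)) h sequentially"
    and glim: "uniform_limit K (\<lambda>n. gs (r n)) g sequentially"
    if K: "compact K" "K \<subseteq> ball 0 1" for K
    using filterlim_compose[OF h(3)[OF K] filterlim_subseq[OF g(2)]] g(3)[OF K]
    by (simp_all add: r_def o_def)
  have pt: "(\<lambda>n. hs (r n) 0) \<longlonglongrightarrow> h 0" "(\<lambda>n. gs (r n) 0) \<longlonglongrightarrow> g 0"
    using tendsto_uniform_limitI[OF hlim[of "{0}"]] tendsto_uniform_limitI[OF glim[of "{0}"]] by auto
  have d: "(\<lambda>n. deriv (hs (r n)) z) \<longlonglongrightarrow> deriv h z" "(\<lambda>n. deriv (gs (r n)) z) \<longlonglongrightarrow> deriv g z"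
    if "z \<in> ball 0 1" for z
    using hg' that hlim glim h(1) g(1)
    by (intro uniform_limit_deriv_tendsto[of _ "ball 0 1"]; auto)+
  have 0: "h 0 = 0" "g 0 = 0" using pt hg' by (auto simp: LIMSEQ_const_iff)
  have 1: "deriv h 0 = 1" "deriv g 0 = 0" using d[of 0] hg' by (auto simp: LIMSEQ_const_iff)
  have pos: "cmod (deriv g z) < Re (deriv h z)" if z: "z \<in> ball 0 1" for z
    unfolding Re_pos_rotations_iff[symmetric]
  proof (intro allI impI)
    fix \<epsilon> :: complex assume e: "cmod \<epsilon> = 1"
    show "0 < Re (deriv h z + \<epsilon> * deriv g z)"
    proof (rule Re_pos_if_Re_nonneg[of "\<lambda>z. deriv h z + \<epsilon> * deriv g z" "ball 0 1" 0])
      show "(\<lambda>z. deriv h z + \<epsilon> * deriv g z) holomorphic_on ball 0 1"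
        using h(1) g(1) by (auto intro!: holomorphic_intros holomorphic_deriv)
      show "0 \<le> Re (deriv h w + \<epsilon> * deriv g w)" if w: "w \<in> ball 0 1" for w
      proof (rule tendsto_lowerbound)
        show "(\<lambda>n. Re (deriv (hs (r n)) w + \<epsilon> * deriv (gs (r n)) w)) \<longlonglongrightarrow> Re (deriv h w + \<epsilon> * deriv g w)"
          by (intro tendsto_intros d w)
        show "\<forall>\<^sub>F n in sequentially. 0 \<le> Re (deriv (hs (r n)) w + \<epsilon> * deriv (gs (r n)) w)"
          using classRH0_Caratheodory(3)[OF hg e w] less_imp_le by (intro always_eventually allI) blast
      qed simp
    qed (use 1 z in auto)
  qed
  have "(h, g) \<in> classRH0" using 0 1 pos h(1) g(1) by (simp add: classRH0_iff)
  moreover have "uniform_limit K (\<lambda>n. harm (hs (r n), gs (r n))) (harm (h, g)) sequentially"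
    if "compact K" "K \<subseteq> ball 0 1" for K
    unfolding harm_def fst_conv snd_conv
    by (intro uniform_limit_add hlim that bounded_linear.uniform_limit[OF bounded_linear_cnj] glim)
  ultimately show ?thesis using that r by blast
qed

section \<open>The extremal function\<close>

lemma one_minus_notin_nonpos_Reals: "cmod z < 1 \<Longrightarrow> 1 - z \<notin> \<real>\<^sub>\<le>\<^sub>0"
  using complex_Re_le_cmod[of z] by (auto simp: complex_nonpos_Reals_iff)

lemma fst_f0_has_field_derivative:
  assumes "z \<in> ball 0 1"
  shows "(fst f0 has_field_derivative (1 + z) / (1 - z)) (at z)"
proof -
  have "1 - z \<notin> \<real>\<^sub>\<le>\<^sub>0" "z \<noteq> 1" using assms one_minus_notin_nonpos_Reals by auto
  then show ?thesis
    unfolding f0_def by (auto intro!: derivative_eq_intros simp: field_simps)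
qed

lemma f0_in_classRH0: "f0 \<in> classRH0"
proof -
  have d: "deriv (fst f0) z = (1 + z) / (1 - z)" if "z \<in> ball 0 1" for z
    using fst_f0_has_field_derivative[OF that] by (rule DERIV_imp_deriv)
  have "fst f0 holomorphic_on ball 0 1"
    unfolding holomorphic_on_open[OF open_ball] using fst_f0_has_field_derivative by blast
  moreover have "0 < Re (deriv (fst f0) z)" if z: "z \<in> ball 0 1" for z
  proof -
    have "Re ((1 + z) / (1 - z)) = (1 - (cmod z)\<^sup>2) / (cmod (1 - z))\<^sup>2"
      unfolding Re_divide cmod_power2 by (simp add: power2_eq_square algebra_simps)
    moreover have "(cmod z)\<^sup>2 < 1" using z by (simp add: power_less_one_iff abs_square_less_1)
    moreover have "z \<noteq> 1" using z by auto
    ultimately show ?thesis using d[OF z] by simp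
  qed
  moreover have "(fst f0, snd f0) \<in> classRH0 \<longleftrightarrow> f0 \<in> classRH0" by simp
  ultimately show ?thesis
    using d[of 0] by (auto simp: classRH0_iff f0_def)
qed

lemma coef_f0:
  assumes "2 \<le> n"
  shows "coef (fst f0) n = complex_of_real (2 / real n)" "coef (snd f0) n = 0"
proof -
  obtain m where m: "n = Suc m" "m \<noteq> 0" using assms by (cases n) auto
  have "coef (deriv (fst f0)) m = (if m = 0 then 1 else 2)"
  proof (rule coef_unique[of 1])
    fix z :: complex assume z: "z \<in> ball 0 1"
    \<comment> \<open>The splitting \<open>(1 + z) / (1 - z) = 2 / (1 - z) - 1\<close> shows the
      coefficients 1, 2, 2, and so on.\<close>
    have "(\<lambda>n. 2 * z ^ n + (if n = 0 then - 1 else 0)) sums (2 * (1 / (1 - z)) + - 1)"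
      using z by (intro sums_add sums_mult geometric_sums sums_single[of 0 "\<lambda>_. -1"]) auto
    moreover have "1 - z \<noteq> 0" using z by auto
    then have "2 * (1 / (1 - z)) + - 1 = deriv (fst f0) z"
      unfolding DERIV_imp_deriv[OF fst_f0_has_field_derivative[OF z]] by (simp add: field_simps)
    moreover have "(\<lambda>n. 2 * z ^ n + (if n = 0 then - 1 else 0)) = (\<lambda>n. (if n = 0 then 1 else 2) * z ^ n)"
      by auto
    ultimately show "(\<lambda>n. (if n = 0 then 1 else 2) * z ^ n) sums deriv (fst f0) z" by simp
  qed simp
  then have "of_nat n * coef (fst f0) n = 2" using m by (simp add: coef_deriv)
  then show "coef (fst f0) n = complex_of_real (2 / real n)" using assms by (simp add: field_simps)
  show "coef (snd f0) n = 0"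
    by (rule coef_unique[of 1]) (auto simp: f0_def)
qed

lemma harm_f0_of_real:
  assumes "t < 1"
  shows "harm f0 (of_real t) = of_real (- t - 2 * ln (1 - t))"
proof -
  have "Ln (1 - of_real t) = of_real (ln (1 - t))"
    using Ln_of_real[of "1 - t"] assms by simp
  then show ?thesis by (simp add: harm_def f0_def)
qed

lemma harm_f0_sharp:
  assumes r: "0 \<le> r" "r < 1"
  shows "cmod (harm f0 (complex_of_real r)) = - r - 2 * ln (1 - r)"
    and "cmod (harm f0 (complex_of_real (- r))) = - r + 2 * ln (1 + r)"
proof -
  have "ln (1 - r) \<le> (1 - r) - 1" using r by (intro ln_le_minus_one) auto
  then have "0 \<le> - r - 2 * ln (1 - r)" using r by simp
  then show "cmod (harm f0 (complex_of_real r)) = - r - 2 * ln (1 - r)"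
    unfolding harm_f0_of_real[OF r(2)] norm_of_real by simp
  \<comment> \<open>To remove the modulus the sign is needed: this yields
    \<open>r / (1 + r) \<le> ln (1 + r)\<close>, and \<open>r / 2 \<le> r / (1 + r)\<close> as
    \<open>r \<le> 1\<close>.\<close>
  have "ln (1 / (1 + r)) \<le> 1 / (1 + r) - 1" using r by (intro ln_le_minus_one) auto
  then have "1 - 1 / (1 + r) \<le> ln (1 + r)" using r by (simp add: ln_div)
  moreover have "r / 2 \<le> 1 - 1 / (1 + r)" using r mult_left_mono[of r 1 r] by (simp add: field_simps)
  ultimately have "0 \<le> - r + 2 * ln (1 + r)" by simp
  moreover have "- r < 1" using r by simp
  ultimately show "cmod (harm f0 (complex_of_real (- r))) = - r + 2 * ln (1 + r)"
    unfolding harm_f0_of_real[OF \<open>- r < 1\<close>] norm_of_real by simp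
qed

text \<open>The point is the radial limit of \<open>harm f0\<close> at \<open>-1\<close>.
  Monotonicity passes to that limit, so it is a value of the extension over a boundary point and
  hence omitted. Its modulus \<open>2 * ln 2 - 1\<close> shows that the covering radius is
  sharp.\<close>

lemma f0_omits: "complex_of_real (1 - 2 * ln 2) \<notin> harm f0 ` ball 0 1"
proof -
  have f0: "(fst f0, snd f0) \<in> classRH0" using f0_in_classRH0 by simp
  have mono: "strictly_monotone_on (ball 0 1) (harm f0)"
    using classRH0_strictly_monotone[OF f0, of 1 "ball 0 1"] by (simp add: harm_def)
  have "complex_of_real (1 - 2 * ln 2) \<in> monotone_ext (ball 0 1) (harm f0) (-1)"
    unfolding monotone_ext_def mem_Collect_eq
  proof
    fix w :: complex assume w: "w \<in> ball 0 1"
    show "0 \<le> (harm f0 w - complex_of_real (1 - 2 * ln 2)) \<bullet> (w - - 1)"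
    proof (rule tendsto_lowerbound)
      have "((\<lambda>s. (harm f0 w - of_real (s - 2 * ln (1 + s))) \<bullet> (w - of_real (- s))) \<longlongrightarrow>
        (harm f0 w - of_real (1 - 2 * ln (1 + 1))) \<bullet> (w - of_real (- 1))) (at_left 1)"
        by (intro tendsto_intros) auto
      then show "((\<lambda>s. (harm f0 w - of_real (s - 2 * ln (1 + s))) \<bullet> (w - of_real (- s))) \<longlongrightarrow>
        (harm f0 w - complex_of_real (1 - 2 * ln 2)) \<bullet> (w - - 1)) (at_left 1)" by simp
      have "0 \<le> (harm f0 w - of_real (s - 2 * ln (1 + s))) \<bullet> (w - of_real (- s))"
        if s: "s \<in> {0<..<1}" for s
        using strictly_monotone_on_le[OF mono w, of "of_real (- s)"] harm_f0_of_real[of "- s"] s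
        by simp
      then show "\<forall>\<^sub>F s in at_left 1. 0 \<le> (harm f0 w - of_real (s - 2 * ln (1 + s))) \<bullet> (w - of_real (- s))"
        by (rule eventually_mono[OF eventually_at_left_real[OF zero_less_one]])
    qed simp
  qed
  then show ?thesis
    by (rule monotone_ext_frontier_notin_image[OF mono open_ball, rotated]) simp
qed

lemma Re_harm_f0:
  assumes "cmod z < 1"
  shows "Re (harm f0 z) = - Re z - ln ((cmod (1 - z))\<^sup>2)"
proof -
  have "1 - z \<noteq> 0" using assms by auto
  then show ?thesis by (simp add: harm_def f0_def ln_realpow)
qed

text \<open>If the image of \<^term>\<open>ball 0 r\<close> were convex, then by its symmetry about the real axis the real part
  of \<^term>\<open>harm f0\<close> would nowhere be less than its limit at \<^term>\<open>- r\<close>. But on the circle of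
  radius \<^term>\<open>r\<close> it is a function \<open>\<phi>\<close> of the cosine of the argument that is strictly decreasing at \<open>-1\<close>.\<close>
lemma f0_image_nonconvex:
  assumes r: "sqrt 2 - 1 < r" "r \<le> 1"
  shows "\<not> convex (harm f0 ` ball 0 r)"
proof
  assume conv: "convex (harm f0 ` ball 0 r)"
  let ?f = "harm f0"
  have r0: "0 < r" using r(1) real_sqrt_ge_1_iff[of 2] by linarith
  have f0: "(fst f0, snd f0) \<in> classRH0" using f0_in_classRH0 by simp
  have sub: "ball (0::complex) r \<subseteq> ball 0 1" using r by auto
  have inj: "inj_on ?f (ball 0 r)"
    using classRH0_close_to_convex(1)[OF f0, of 1 r] r r0 by (simp add: harm_def)
  have cnj: "?f (cnj z) = cnj (?f z)" if "z \<in> ball 0 r" for z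
    using cnj_Ln[OF one_minus_notin_nonpos_Reals[of z]] that sub
    by (auto simp: harm_def f0_def)
  define \<kappa> where "\<kappa> = (\<lambda>t::real. - t - 2 * ln (1 - t))"
  have real_ge: "\<kappa> (- r) \<le> Re (?f z)" if z: "z \<in> ball 0 r" for z
  proof -
    have "?f z \<in> ?f ` ball 0 r" "?f (cnj z) \<in> ?f ` ball 0 r" using z by auto
    then have "(1 - 1/2) *\<^sub>R ?f z + (1/2) *\<^sub>R ?f (cnj z) \<in> ?f ` ball 0 r"
      by (intro convexD_alt[OF conv]) auto
    moreover have "(1 - 1/2) *\<^sub>R ?f z + (1/2) *\<^sub>R ?f (cnj z) = of_real (Re (?f z))"
      unfolding cnj[OF z] by (simp add: complex_eq_iff)
    ultimately obtain x where x: "x \<in> ball 0 r" "?f x = of_real (Re (?f z))" by auto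
    \<comment> \<open>A real value can only come from a real point, by symmetry and
      univalence.\<close>
    have "?f (cnj x) = ?f x" unfolding cnj[OF x(1)] x(2) by simp
    then have "cnj x = x" by (rule inj_onD[OF inj]) (use x in auto)
    then have xr: "x = of_real (Re x)" by (simp add: complex_eq_iff)
    then have t: "\<bar>Re x\<bar> < r" using x(1) by (metis mem_ball_0 norm_of_real)
    have "?f x = of_real (\<kappa> (Re x))"
      using harm_f0_of_real[of "Re x"] xr t r by (simp add: \<kappa>_def)
    then have "Re (?f z) = \<kappa> (Re x)" using x(2) by (metis of_real_eq_iff)
    moreover have "\<kappa> (- r) \<le> \<kappa> (Re x)"
    proof (rule DERIV_nonneg_imp_nondecreasing[of "- r" "Re x" \<kappa>])
      fix s assume s: "- r \<le> s" "s \<le> Re x"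
      then have s1: "s < 1" "- 1 \<le> s" using t r by auto
      then have "(\<kappa> has_real_derivative (1 + s) / (1 - s)) (at s)"
        unfolding \<kappa>_def by (auto intro!: derivative_eq_intros simp: field_simps)
      then show "\<exists>y. (\<kappa> has_real_derivative y) (at s) \<and> 0 \<le> y" using s1 by (intro exI conjI) auto
    qed (use t in auto)
    ultimately show ?thesis by simp
  qed
  define \<phi> where "\<phi> = (\<lambda>(s::real) c. - s * c - ln (1 - 2 * s * c + s\<^sup>2))"
  have pos: "0 < 1 - 2 * s * c + s\<^sup>2" if c: "- 1 \<le> c" "c < 1" and s: "0 < s" "s \<le> 1" for s c :: real
  proof -
    have "0 < 2 * s * (1 - c)" using c s by simp
    moreover have "0 \<le> (1 - s)\<^sup>2" by simp
    ultimately show ?thesis by (simp add: power2_eq_square algebra_simps)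
  qed
  \<comment> \<open>The circle of radius \<open>r\<close> is not in the open ball, so it is
    approached through smaller radii \<open>s\<close>. Keeping \<open>c < 1\<close> avoids the
    singularity that occurs when \<open>r = 1\<close>.\<close>
  have ge: "\<kappa> (- r) \<le> \<phi> r c" if c: "- 1 \<le> c" "c < 1" for c
  proof (rule tendsto_lowerbound)
    show "((\<lambda>s. \<phi> s c) \<longlongrightarrow> \<phi> r c) (at_left r)"
      unfolding \<phi>_def using pos[OF c, of r] r0 r by (intro tendsto_intros) auto
    have "\<kappa> (- r) \<le> \<phi> s c" if s: "s \<in> {0<..<r}" for s
    proof -
      define z where "z = Complex (s * c) (s * sqrt (1 - c\<^sup>2))"
      have c2: "c\<^sup>2 \<le> 1" using c by (simp add: abs_square_le_1)
      have "(cmod z)\<^sup>2 = s\<^sup>2"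
        using c2 by (simp add: z_def cmod_power2 power_mult_distrib algebra_simps)
      then have nz: "cmod z = s" using s by (simp add: power2_eq_iff_nonneg)
      have "(cmod (1 - z))\<^sup>2 = 1 - 2 * s * c + s\<^sup>2"
        using c2 by (simp add: z_def cmod_power2 power_mult_distrib power2_diff algebra_simps)
      then have "Re (?f z) = \<phi> s c"
        using Re_harm_f0[of z] nz s r by (simp add: \<phi>_def z_def)
      then show ?thesis using real_ge[of z] nz s by simp
    qed
    then show "\<forall>\<^sub>F s in at_left r. \<kappa> (- r) \<le> \<phi> s c"
      by (rule eventually_mono[OF eventually_at_left_real[OF r0]])
  qed simp
  have p1: "1 - 2 * r * (- 1) + r\<^sup>2 = (1 + r)\<^sup>2" by (simp add: power2_eq_square algebra_simps)
  have eq: "\<phi> r (- 1) = \<kappa> (- r)"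
    using r0 unfolding \<phi>_def \<kappa>_def p1 by (simp add: ln_realpow)
  have "(\<phi> r has_real_derivative (- r + 2 * r / (1 + r)\<^sup>2)) (at (- 1))"
    using pos[of "- 1" r] r0 r unfolding \<phi>_def
    by (auto intro!: derivative_eq_intros simp flip: p1)
  \<comment> \<open>The sign is negative exactly when \<open>(1 + r)\<^sup>2 > 2\<close>, which is
    where \<open>sqrt 2 - 1\<close> enters from below.\<close>
  moreover have "- r + 2 * r / (1 + r)\<^sup>2 < 0"
  proof -
    have "sqrt 2 < 1 + r" using r by simp
    then have "(sqrt 2)\<^sup>2 < (1 + r)\<^sup>2" by (intro power_strict_mono) auto
    then have "2 / (1 + r)\<^sup>2 < 1" using r0 by simp
    then have "r * (2 / (1 + r)\<^sup>2) < r * 1" using r0 by (intro mult_strict_left_mono)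
    then show ?thesis by (simp add: mult.commute)
  qed
  ultimately obtain d where d: "0 < d" "\<And>h. 0 < h \<Longrightarrow> h < d \<Longrightarrow> \<phi> r (- 1 + h) < \<phi> r (- 1)"
    using DERIV_neg_dec_right by metis
  define h where "h = min (d / 2) 1"
  have "0 < h" "h < d" "h \<le> 1" using d(1) by (auto simp: h_def)
  then show False using d(2)[of h] ge[of "- 1 + h"] eq by simp
qed

section \<open>The radius of convexity\<close>

text \<open>As \<^term>\<open>\<psi>\<close> runs from \<^term>\<open>\<psi> a\<close> to \<^term>\<open>\<psi> a + 2 * pi\<close>, the height of \<^term>\<open>F\<close> in the
  direction \<^term>\<open>cis (\<psi> a)\<close> first decreases and then increases back to its initial value.\<close>
lemma closed_curve_support:
  fixes F :: "real \<Rightarrow> complex" and \<rho> \<psi> :: "real \<Rightarrow> real"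
  assumes F: "\<And>x. (F has_vector_derivative \<i> * (of_real (\<rho> x) * cis (\<psi> x))) (at x)"
    and \<rho>: "\<And>x. 0 \<le> \<rho> x" and mono: "mono \<psi>"
    and per: "\<psi> (a + 2 * pi) = \<psi> a + 2 * pi" "F (a + 2 * pi) = F a"
    and x: "a \<le> x" "x \<le> a + 2 * pi"
  shows "Re (cis (- \<psi> a) * F x) \<le> Re (cis (- \<psi> a) * F a)"
proof -
  define u where "u = (\<lambda>x. Re (cis (- \<psi> a) * F x))"
  have du: "(u has_real_derivative - (\<rho> x * sin (\<psi> x - \<psi> a))) (at x)" for x
  proof -
    have "(u has_real_derivative Re (cis (- \<psi> a) * (\<i> * (of_real (\<rho> x) * cis (\<psi> x))))) (at x)"
      unfolding has_real_derivative_iff_has_vector_derivative u_def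
      by (intro bounded_linear.has_vector_derivative[OF bounded_linear_Re] has_vector_derivative_mult_right F)
    also have "cis (- \<psi> a) * (\<i> * (of_real (\<rho> x) * cis (\<psi> x))) = of_real (\<rho> x) * (\<i> * cis (\<psi> x - \<psi> a))"
    proof -
      have c: "cis (\<psi> x - \<psi> a) = cis (- \<psi> a) * cis (\<psi> x)" by (simp add: cis_mult)
      show ?thesis by (simp only: c mult_ac)
    qed
    finally show ?thesis by simp
  qed
  show ?thesis
  proof (cases "\<psi> x - \<psi> a \<le> pi")
    case True
    have "u x \<le> u a"
    proof (rule DERIV_nonpos_imp_nonincreasing[OF x(1)])
      fix y assume y: "a \<le> y" "y \<le> x"
      have "0 \<le> \<psi> y - \<psi> a" "\<psi> y - \<psi> a \<le> pi" using monoD[OF mono y(1)] monoD[OF mono y(2)] True by auto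
      then have "0 \<le> \<rho> y * sin (\<psi> y - \<psi> a)" using \<rho> sin_ge_zero by simp
      then show "\<exists>d. (u has_real_derivative d) (at y) \<and> d \<le> 0" using du[of y] by auto
    qed
    then show ?thesis by (simp add: u_def)
  next
    case False
    have "u x \<le> u (a + 2 * pi)"
    proof (rule DERIV_nonneg_imp_nondecreasing[OF x(2)])
      fix y assume y: "x \<le> y" "y \<le> a + 2 * pi"
      have "pi \<le> \<psi> y - \<psi> a" "\<psi> y - \<psi> a \<le> 2 * pi"
        using monoD[OF mono y(1)] monoD[OF mono y(2)] False per(1) by auto
      then have "sin (\<psi> y - \<psi> a) \<le> 0" using sin_le_zero[of "\<psi> y - \<psi> a"] by (cases "\<psi> y - \<psi> a = 2 * pi") auto
      then have "\<rho> y * sin (\<psi> y - \<psi> a) \<le> 0" using \<rho>[of y] by (simp add: mult_nonneg_nonpos)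
      then show "\<exists>d. (u has_real_derivative d) (at y) \<and> 0 \<le> d" using du[of y] by fastforce
    qed
    then show ?thesis by (simp add: u_def per(2))
  qed
qed

text \<open>A segment leaving the image would meet its frontier in a point \<open>f \<zeta>\<close>
  with \<open>cmod \<zeta> = r\<close>. The functional supporting there is strictly smaller on the
  open image, in particular at both ends of the segment, hence also at the point itself.\<close>

lemma convex_image_if_support:
  fixes f :: "complex \<Rightarrow> complex"
  assumes cont: "continuous_on (cball 0 r) f" and op: "open (f ` ball 0 r)" and r: "0 < r"
    and supp: "\<And>\<zeta>. cmod \<zeta> = r \<Longrightarrow> \<exists>v. v \<noteq> 0 \<and> (\<forall>w. cmod w = r \<longrightarrow> Re (v * f w) \<le> Re (v * f \<zeta>))"
  shows "convex (f ` ball 0 r)"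
proof -
  have bigger: "\<exists>w'\<in>ball 0 r. Re (v * f w) < Re (v * f w')" if v: "v \<noteq> 0" and w: "w \<in> ball 0 r" for v w
  proof -
    obtain e where e: "0 < e" "ball (f w) e \<subseteq> f ` ball 0 r" using op w by (meson imageI openE)
    \<comment> \<open>A displacement by \<open>e / 2\<close> in the direction \<open>cnj v\<close>,
      in which \<open>Re (v * _)\<close> increases fastest.\<close>
    define q where "q = f w + of_real (e / (2 * cmod v)) * cnj v"
    have "dist (f w) q = cmod (of_real (e / (2 * cmod v)) * cnj v)"
      by (simp add: q_def dist_norm del: of_real_divide of_real_mult)
    also have "\<dots> = e / 2" unfolding norm_mult norm_of_real using e v by simp
    finally have "dist (f w) q = e / 2" .
    then have "q \<in> f ` ball 0 r" using e by (intro subsetD[OF e(2)]) auto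
    then obtain w' where "w' \<in> ball 0 r" "q = f w'" by auto
    moreover have "Re (v * q) = Re (v * f w) + e / (2 * cmod v) * (cmod v)\<^sup>2"
    proof -
      have "v * q = v * f w + of_real (e / (2 * cmod v)) * (v * cnj v)"
        by (simp add: q_def algebra_simps)
      then show ?thesis unfolding complex_norm_square[symmetric] of_real_power[symmetric]
        by (simp only: Re_complex_of_real plus_complex.sel of_real_mult[symmetric])
    qed
    moreover have "0 < e / (2 * cmod v) * (cmod v)\<^sup>2" using e v by simp
    ultimately show ?thesis by (intro bexI[of _ w']) auto
  qed
  have strict: "Re (v * f w) < Re (v * f \<zeta>)"
    if v: "v \<noteq> 0" "\<forall>w. cmod w = r \<longrightarrow> Re (v * f w) \<le> Re (v * f \<zeta>)" and w: "w \<in> ball 0 r" for v w \<zeta>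
  proof -
    have "continuous_on (cball 0 r) (\<lambda>w. Re (v * f w))" by (intro continuous_intros cont)
    then obtain m where m: "m \<in> cball 0 r" "\<And>w. w \<in> cball 0 r \<Longrightarrow> Re (v * f w) \<le> Re (v * f m)"
      using continuous_attains_sup[of "cball 0 r" "\<lambda>w. Re (v * f w)"] r by force
    have "m \<notin> ball 0 r"
    proof
      assume "m \<in> ball 0 r"
      then obtain w' where "w' \<in> ball 0 r" "Re (v * f m) < Re (v * f w')" using bigger[OF v(1)] by blast
      then show False using m(2)[of w'] by auto
    qed
    then have "Re (v * f m) \<le> Re (v * f \<zeta>)" using m(1) v(2) by auto
    moreover obtain w' where "w' \<in> ball 0 r" "Re (v * f w) < Re (v * f w')" using bigger[OF v(1) w] by blast
    ultimately show ?thesis using m(2)[of w'] by auto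
  qed
  show ?thesis
    unfolding convex_contains_segment
  proof (intro ballI)
    fix a b assume ab: "a \<in> f ` ball 0 r" "b \<in> f ` ball 0 r"
    show "closed_segment a b \<subseteq> f ` ball 0 r"
    proof (rule ccontr)
      assume "\<not> ?thesis"
      then have "closed_segment a b \<inter> frontier (f ` ball 0 r) \<noteq> {}"
        using ab by (intro connected_Int_frontier) auto
      then obtain q where q: "q \<in> closed_segment a b" "q \<in> frontier (f ` ball 0 r)" by blast
      have "f ` ball 0 r \<subseteq> f ` cball 0 r" by auto
      moreover have "closed (f ` cball 0 r)"
        by (intro compact_imp_closed compact_continuous_image cont) simp
      ultimately have "closure (f ` ball 0 r) \<subseteq> f ` cball 0 r" by (rule closure_minimal)
      then have "q \<in> f ` cball 0 r" "q \<notin> f ` ball 0 r"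
        using q(2) op by (auto simp: frontier_def interior_open)
      then obtain \<zeta> where \<zeta>: "q = f \<zeta>" "cmod \<zeta> = r" by fastforce
      obtain v where v: "v \<noteq> 0" "\<forall>w. cmod w = r \<longrightarrow> Re (v * f w) \<le> Re (v * f \<zeta>)"
        using supp[OF \<zeta>(2)] by blast
      have lt: "Re (v * a) < Re (v * q)" "Re (v * b) < Re (v * q)"
        using ab strict[OF v] \<zeta>(1) by auto
      obtain t where t: "0 \<le> t" "t \<le> 1" "q = (1 - t) *\<^sub>R a + t *\<^sub>R b"
        using q(1) by (auto simp: in_segment)
      have "Re (v * q) = (1 - t) * Re (v * a) + t * Re (v * b)"
        by (simp add: t(3) algebra_simps)
      also have "\<dots> < Re (v * q)"
        using lt t(1,2) by (intro convex_bound_lt) auto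
      finally show False by simp
    qed
  qed
qed

text \<open>The image of the unit disk under the Moebius map \<^term>\<open>\<lambda>\<epsilon>. (A + \<epsilon> * B) / (H + \<epsilon> * G)\<close> is a disk with
  centre \<^term>\<open>(A * cnj H - B * cnj G) / ((cmod H)\<^sup>2 - (cmod G)\<^sup>2)\<close> and
  radius \<^term>\<open>cmod (B * H - A * G) / ((cmod H)\<^sup>2 - (cmod G)\<^sup>2)\<close>; the hypothesis says that it
  lies in the closed right half plane.\<close>
lemma Re_rotations_imp_harmonic:
  assumes lt: "cmod G < cmod H"
    and rot: "\<And>\<epsilon>. cmod \<epsilon> = 1 \<Longrightarrow> 0 \<le> Re ((A + \<epsilon> * B) * cnj (H + \<epsilon> * G))"
  shows "0 \<le> Re ((A + cnj B) * cnj (H - cnj G))"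
proof -
  define p where "p = Re (A * cnj H)"
  define q where "q = Re (B * cnj G)"
  \<comment> \<open>Under the real part one cross term may be conjugated, so that everything linear
    in \<open>\<epsilon>\<close> becomes \<open>Re (\<epsilon> * W)\<close>.\<close>
  define W where "W = B * cnj H + cnj A * G"
  have le: "cmod W \<le> p + q"
  proof -
    obtain \<epsilon> where e: "cmod \<epsilon> = 1" "\<epsilon> * W = of_real (cmod W) * (- 1)"
      using unit_rotation_exists[of "- 1"] by auto
    have e1: "\<epsilon> * cnj \<epsilon> = 1" using e(1) complex_norm_square[of \<epsilon>] by simp
    have "(A + \<epsilon> * B) * cnj (H + \<epsilon> * G) = A * cnj H + (\<epsilon> * cnj \<epsilon>) * (B * cnj G) + \<epsilon> * B * cnj H + cnj (\<epsilon> * cnj A * G)"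
      by (simp add: algebra_simps)
    then have "Re ((A + \<epsilon> * B) * cnj (H + \<epsilon> * G)) = p + q + (Re (\<epsilon> * B * cnj H) + Re (\<epsilon> * cnj A * G))"
      unfolding e1 p_def q_def by (simp only: plus_complex.sel complex_cnj cnj.sel mult_1)
    also have "Re (\<epsilon> * B * cnj H) + Re (\<epsilon> * cnj A * G) = Re (\<epsilon> * W)"
      unfolding W_def by (simp only: plus_complex.sel[symmetric] distrib_left mult.assoc)
    also have "\<dots> = - cmod W" unfolding e(2) by simp
    finally show ?thesis using rot[OF e(1)] by simp
  qed
  have sq: "(p - q)\<^sup>2 - (cmod (B * H - A * G))\<^sup>2 = (p + q)\<^sup>2 - (cmod W)\<^sup>2"
    unfolding p_def q_def W_def cmod_power2 by (simp add: power2_eq_square) algebra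
  \<comment> \<open>The identity \<open>sq\<close> controls only the square of \<open>p - q\<close>.
    Its sign is settled by this second identity together with
    \<open>cmod G < cmod H\<close>.\<close>
  have "q * (cmod H)\<^sup>2 + p * (cmod G)\<^sup>2 = Re (W * (cnj G * H))"
    unfolding p_def q_def W_def cmod_power2 by (simp add: power2_eq_square) algebra
  also have "\<dots> \<le> cmod W * (cmod G * cmod H)"
    using complex_Re_le_cmod[of "W * (cnj G * H)"] by (simp add: norm_mult)
  also have "\<dots> \<le> (p + q) * (cmod G * cmod H)" by (intro mult_right_mono le) auto
  finally have "(cmod H - cmod G) * (q * cmod H - p * cmod G) \<le> 0"
    by (simp add: power2_eq_square algebra_simps)
  then have qp: "q * cmod H \<le> p * cmod G" using lt by (simp add: mult_le_0_iff)
  have "0 \<le> p + q" using le norm_ge_zero[of W] by linarith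
  have "q \<le> p"
  proof (rule ccontr)
    assume "\<not> q \<le> p"
    then have "0 < q" using \<open>0 \<le> p + q\<close> by linarith
    have "q * cmod G \<le> q * cmod H" using lt \<open>0 < q\<close> by simp
    have "p * cmod G \<le> q * cmod G" using \<open>\<not> q \<le> p\<close> by (intro mult_right_mono) auto
    then have "q * cmod H \<le> q * cmod G" using qp by linarith
    then show False using lt \<open>0 < q\<close> by simp
  qed
  have "(cmod W)\<^sup>2 \<le> (p + q)\<^sup>2" using le by (intro power_mono) auto
  then have "(cmod (B * H - A * G))\<^sup>2 \<le> (p - q)\<^sup>2" using sq by linarith
  then have "cmod (B * H - A * G) \<le> p - q" by (rule power2_le_imp_le) (use \<open>q \<le> p\<close> in simp)
  moreover have "Re ((A + cnj B) * cnj (H - cnj G)) = p - q + Re (B * H - A * G)"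
    unfolding p_def q_def by (simp add: algebra_simps)
  ultimately show ?thesis using abs_Re_le_cmod[of "B * H - A * G"] by linarith
qed

text \<open>For a rotation \<open>P = deriv h + \<epsilon> * deriv g\<close> the condition to be
  checked is \<open>0 \<le> Re (1 + z * deriv P z / P z)\<close>, cleared of denominators. It
  follows from \<open>cmod (z * deriv P z) \<le> cmod (P z)\<close>, which Schwarz--Pick gives
  because \<open>2 * r \<le> 1 - r\<^sup>2\<close>.\<close>

lemma classRH0_curvature:
  assumes hg: "(h, g) \<in> classRH0" and z: "z \<noteq> 0" "cmod z \<le> sqrt 2 - 1"
  defines "A \<equiv> z * (deriv h z + z * deriv (deriv h) z)"
    and "B \<equiv> z * (deriv g z + z * deriv (deriv g) z)"
  shows "0 \<le> Re ((A + cnj B) * cnj (z * deriv h z - cnj (z * deriv g z)))"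
proof (rule Re_rotations_imp_harmonic)
  note hg' = hg[unfolded classRH0_iff]
  define r where "r = cmod z"
  have r: "0 < r" "r \<le> sqrt 2 - 1" using z by (auto simp: r_def)
  have "sqrt 2 < 2" by (rule real_less_lsqrt) auto
  then have "r < 1" using r by linarith
  then have z1: "z \<in> ball 0 1" by (simp add: r_def)
  have "(r + 1)\<^sup>2 \<le> (sqrt 2)\<^sup>2" using r by (intro power_mono) auto
  then have r2: "2 * r \<le> 1 - r\<^sup>2" by (simp add: power2_eq_square algebra_simps)
  have "cmod (deriv g z) < cmod (deriv h z)"
    using hg' z1 complex_Re_le_cmod[of "deriv h z"] by fastforce
  then show "cmod (z * deriv g z) < cmod (z * deriv h z)" using z(1) by (simp add: norm_mult)
  fix \<epsilon> :: complex assume e: "cmod \<epsilon> = 1"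
  define P where "P = (\<lambda>z. deriv h z + \<epsilon> * deriv g z)"
  note P = classRH0_Caratheodory[OF hg e, folded P_def]
  have dP: "deriv P z = deriv (deriv h) z + \<epsilon> * deriv (deriv g) z"
    unfolding P_def using hg' z1 by (intro deriv_add_cmult[of _ "ball 0 1"] holomorphic_deriv) auto
  have "(1 - r\<^sup>2) * cmod (deriv P z) \<le> 2 * Re (P z)"
    unfolding r_def using Schwarz_Pick_Re_pos[of P z] P(1,3) z1 by (simp add: P_def)
  moreover have "2 * r * cmod (deriv P z) \<le> (1 - r\<^sup>2) * cmod (deriv P z)"
    using r2 by (intro mult_right_mono) auto
  ultimately have le: "r * cmod (deriv P z) \<le> cmod (P z)"
    using complex_Re_le_cmod[of "P z"] by linarith
  have "- Re (z * deriv P z * cnj (P z)) \<le> r * cmod (deriv P z) * cmod (P z)"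
    using abs_Re_le_cmod[of "z * deriv P z * cnj (P z)"] by (simp add: norm_mult r_def)
  also have "\<dots> \<le> cmod (P z) * cmod (P z)" by (intro mult_right_mono le) auto
  finally have "0 \<le> (cmod (P z))\<^sup>2 + Re (z * deriv P z * cnj (P z))" by (simp add: power2_eq_square)
  also have "\<dots> = Re ((P z + z * deriv P z) * cnj (P z))"
    unfolding cmod_power2 by (simp add: power2_eq_square algebra_simps)
  finally have "0 \<le> (cmod z)\<^sup>2 * Re ((P z + z * deriv P z) * cnj (P z))" by simp
  also have "\<dots> = Re (of_real ((cmod z)\<^sup>2) * ((P z + z * deriv P z) * cnj (P z)))" by simp
  also have "of_real ((cmod z)\<^sup>2) * ((P z + z * deriv P z) * cnj (P z))
      = (A + \<epsilon> * B) * cnj (z * deriv h z + \<epsilon> * (z * deriv g z))"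
    unfolding complex_norm_square dP unfolding P_def A_def B_def
    by (simp only: complex_cnj_add complex_cnj_mult algebra_simps)
  finally show "0 \<le> Re ((A + \<epsilon> * B) * cnj (z * deriv h z + \<epsilon> * (z * deriv g z)))" .
qed

lemma has_vector_derivative_circle:
  "((\<lambda>x. of_real r * cis x) has_vector_derivative \<i> * (of_real r * cis x)) (at x)"
proof -
  have "(cis has_vector_derivative \<i> * cis x) (at x)"
    unfolding has_vector_derivative_def using has_derivative_cis[OF has_derivative_ident] by simp
  from has_vector_derivative_mult_right[OF this, of "of_real r"] show ?thesis by (simp add: mult_ac)
qed

lemma classRH0_convex_image:
  assumes hg: "(h, g) \<in> classRH0" and r: "0 < r" "r \<le> sqrt 2 - 1"
  shows "convex (harm (h, g) ` ball 0 r)"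
proof (rule convex_image_if_support[OF _ _ r(1)])
  note hg' = hg[unfolded classRH0_iff]
  have "sqrt 2 < 2" by (rule real_less_lsqrt) auto
  then have r1: "r < 1" using r by linarith
  then have sub: "cball (0::complex) r \<subseteq> ball 0 1" "ball (0::complex) r \<subseteq> ball 0 1" by auto
  show "continuous_on (cball 0 r) (harm (h, g))"
    unfolding harm_eq by (rule classRH0_continuous[OF hg sub(1)])
  show "open (harm (h, g) ` ball 0 r)"
    using classRH0_close_to_convex(2)[OF hg, of 1 r] r r1
    unfolding harm_eq close_to_convex_domain_def by simp
  define z where "z = (\<lambda>x. of_real r * cis x)"
  define N where "N = (\<lambda>x. z x * deriv h (z x) - cnj (z x * deriv g (z x)))"
  \<comment> \<open>The tangent of the image curve is \<open>\<i> * N x\<close>. Its quotient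
    \<open>M x = N x / z x\<close> has positive real part, so the principal logarithm provides a
    smooth tangent angle \<open>\<psi>\<close> that gains exactly \<open>2 * pi\<close> per
    turn.\<close>
  define M where "M = (\<lambda>x. N x * (cis (- x) / of_real r))"
  define \<psi> where "\<psi> = (\<lambda>x. x + Im (Ln (M x)))"
  define X where "X = (\<lambda>x. z x * (deriv h (z x) + z x * deriv (deriv h) (z x))
    + cnj (z x * (deriv g (z x) + z x * deriv (deriv g) (z x))))"
  have nz: "cmod (z x) = r" "z x \<noteq> 0" for x using r by (auto simp: z_def norm_mult)
  then have zb: "z x \<in> ball 0 1" for x using r1 by simp
  have dz: "(z has_vector_derivative \<i> * z x) (at x)" for x
    unfolding z_def by (rule has_vector_derivative_circle)
  have comp: "((\<lambda>x. k (z x)) has_vector_derivative \<i> * (z x * deriv k (z x))) (at x)"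
    if "k holomorphic_on ball 0 1" for k x
    using field_vector_diff_chain_at[OF dz holomorphic_derivI[OF that open_ball zb]]
    by (simp add: o_def mult_ac)
  have dF: "((\<lambda>x. harm (h, g) (z x)) has_vector_derivative \<i> * N x) (at x)" for x
  proof -
    have "((\<lambda>x. h (z x) + cnj (g (z x))) has_vector_derivative
        (\<i> * (z x * deriv h (z x)) + cnj (\<i> * (z x * deriv g (z x))))) (at x)"
      using hg' by (intro has_vector_derivative_add has_vector_derivative_cnj comp) auto
    then show ?thesis by (simp add: harm_def N_def algebra_simps)
  qed
  have dN: "(N has_vector_derivative \<i> * X x) (at x)" for x
  proof -
    have prod: "((\<lambda>x. z x * deriv k (z x)) has_vector_derivative
        (z x * (\<i> * (z x * deriv (deriv k) (z x))) + \<i> * z x * deriv k (z x))) (at x)"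
      if "k holomorphic_on ball 0 1" for k
      using that by (intro has_vector_derivative_mult dz comp holomorphic_deriv) auto
    have "(N has_vector_derivative
        (z x * (\<i> * (z x * deriv (deriv h) (z x))) + \<i> * z x * deriv h (z x))
        - cnj (z x * (\<i> * (z x * deriv (deriv g) (z x))) + \<i> * z x * deriv g (z x))) (at x)"
      unfolding N_def using hg'
      by (intro has_vector_derivative_diff has_vector_derivative_cnj prod) auto
    then show ?thesis by (simp add: X_def algebra_simps)
  qed
  have NM: "N x = z x * M x" for x
    using r by (simp add: M_def z_def cis_mult)
  have M_eq: "M x = deriv h (z x) - cnj (z x * deriv g (z x)) / z x" for x
    using NM[of x] nz[of x] by (simp add: N_def field_simps)
  have ReM: "0 < Re (M x)" for x
  proof -
    have "cmod (cnj (z x * deriv g (z x)) / z x) = cmod (deriv g (z x))"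
      using nz[of x] r by (simp add: norm_divide norm_mult)
    then have "Re (cnj (z x * deriv g (z x)) / z x) \<le> cmod (deriv g (z x))"
      by (metis complex_Re_le_cmod)
    moreover have "cmod (deriv g (z x)) < Re (deriv h (z x))" using hg' zb[of x] by blast
    ultimately show ?thesis unfolding M_eq minus_complex.sel by linarith
  qed
  have M0: "M x \<noteq> 0" "M x \<notin> \<real>\<^sub>\<le>\<^sub>0" for x
    using ReM[of x] by (auto simp: complex_nonpos_Reals_iff)
  then have N0: "N x \<noteq> 0" for x using NM nz by simp
  \<comment> \<open>The logarithmic derivative of \<open>M = N / z\<close> is
    \<open>\<i> * (X / N) - \<i>\<close>; the resulting \<open>- 1\<close> in the imaginary part is
    cancelled by the summand \<open>x\<close> of \<open>\<psi>\<close>.\<close>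
  have d\<psi>: "(\<psi> has_real_derivative Re (X x * cnj (N x)) / (cmod (N x))\<^sup>2) (at x)" for x
  proof -
    have "((\<lambda>x. cis (- x)) has_vector_derivative - (\<i> * cis (- x))) (at x)"
      unfolding has_vector_derivative_def
      using has_derivative_cis[OF has_derivative_minus[OF has_derivative_ident]] by simp
    then have "((\<lambda>x. cis (- x) / of_real r) has_vector_derivative - (\<i> * cis (- x)) / of_real r) (at x)"
      by (rule has_vector_derivative_divide)
    from has_vector_derivative_mult[OF dN this]
    have "(M has_vector_derivative (N x * (- (\<i> * cis (- x)) / of_real r) + \<i> * X x * (cis (- x) / of_real r))) (at x)"
      unfolding M_def .
    moreover have "N x * (- (\<i> * cis (- x)) / of_real r) + \<i> * X x * (cis (- x) / of_real r)
        = M x * (\<i> * (X x / N x) - \<i>)"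
      using N0[of x] r by (simp add: M_def field_simps)
    ultimately have dM: "(M has_vector_derivative M x * (\<i> * (X x / N x) - \<i>)) (at x)" by simp
    have "((\<lambda>x. Ln (M x)) has_vector_derivative (\<i> * (X x / N x) - \<i>)) (at x)"
    proof -
      have "M x * (\<i> * (X x / N x) - \<i>) * inverse (M x) = \<i> * (X x / N x) - \<i>"
        using M0(1)[of x] by simp
      then show ?thesis
        using field_vector_diff_chain_at[OF dM has_field_derivative_Ln[OF M0(2)]] by (simp only: o_def)
    qed
    from bounded_linear.has_vector_derivative[OF bounded_linear_Im this]
    moreover have "Im (\<i> * (X x / N x) - \<i>) = Re (X x / N x) - 1"
      by (simp del: times_divide_eq_right)
    moreover have "Re (X x / N x) = Re (X x * cnj (N x)) / (cmod (N x))\<^sup>2"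
      unfolding Re_divide cmod_power2 by simp
    ultimately have "((\<lambda>x. Im (Ln (M x))) has_real_derivative Re (X x * cnj (N x)) / (cmod (N x))\<^sup>2 - 1) (at x)"
      unfolding has_real_derivative_iff_has_vector_derivative by (simp only:)
    from DERIV_add[OF DERIV_ident this] show ?thesis by (simp add: \<psi>_def)
  qed
  have mono: "mono \<psi>"
  proof (rule monoI)
    fix x y :: real assume "x \<le> y"
    show "\<psi> x \<le> \<psi> y"
    proof (rule DERIV_nonneg_imp_nondecreasing[OF \<open>x \<le> y\<close>])
      fix t
      have "0 \<le> Re (X t * cnj (N t))"
        unfolding X_def N_def using classRH0_curvature[OF hg nz(2)] nz(1) r by simp
      then show "\<exists>d. (\<psi> has_real_derivative d) (at t) \<and> 0 \<le> d" using d\<psi>[of t] by fastforce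
    qed
  qed
  have N_polar: "N x = of_real (r * cmod (M x)) * cis (\<psi> x)" for x
  proof -
    have "M x = exp (Ln (M x))" using M0 by simp
    also have "\<dots> = of_real (cmod (M x)) * cis (Im (Ln (M x)))"
      using M0(1)[of x] by (simp add: exp_eq_polar)
    finally show ?thesis unfolding NM \<psi>_def cis_mult[symmetric] z_def
      by (metis (no_types, lifting) mult.assoc mult.left_commute of_real_mult)
  qed
  have zper: "z (x + 2 * pi) = z x" for x by (simp add: z_def cis.ctr)
  have support: "Re (cis (- \<psi> a) * harm (h, g) (z x)) \<le> Re (cis (- \<psi> a) * harm (h, g) (z a))"
    if x: "a \<le> x" "x \<le> a + 2 * pi" for a x
  proof (rule closed_curve_support[OF _ _ mono _ _ x])
    show "((\<lambda>x. harm (h, g) (z x)) has_vector_derivative \<i> * (of_real (r * cmod (M x)) * cis (\<psi> x))) (at x)" for x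
      using dF[of x] unfolding N_polar .
    show "\<psi> (a + 2 * pi) = \<psi> a + 2 * pi" by (simp add: \<psi>_def M_eq zper)
  qed (use r in \<open>simp_all add: zper\<close>)
  fix \<zeta> assume \<zeta>: "cmod \<zeta> = r"
  define a where "a = Arg \<zeta>"
  have za: "z (Arg w) = w" if "cmod w = r" for w
    using rcis_cmod_Arg[of w] that by (simp add: z_def rcis_def)
  have "Re (cis (- \<psi> a) * harm (h, g) w) \<le> Re (cis (- \<psi> a) * harm (h, g) \<zeta>)" if w: "cmod w = r" for w
  \<comment> \<open>An argument below \<open>a\<close> is raised by \<open>2 * pi\<close>, so that
    every point of the circle has a parameter in the period starting at \<open>a\<close>.\<close>
  proof (cases "a \<le> Arg w")
    case True
    then show ?thesis
      using support[of a "Arg w"] za[OF w] za[OF \<zeta>] Arg_bounded[of w] Arg_bounded[of \<zeta>]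
      by (simp add: a_def)
  next
    case False
    then show ?thesis
      using support[of a "Arg w + 2 * pi"] za[OF w] za[OF \<zeta>] zper[of "Arg w"] Arg_bounded[of w] Arg_bounded[of \<zeta>]
      by (simp add: a_def)
  qed
  then show "\<exists>v. v \<noteq> 0 \<and> (\<forall>w. cmod w = r \<longrightarrow> Re (v * harm (h, g) w) \<le> Re (v * harm (h, g) \<zeta>))"
    by (intro exI[of _ "cis (- \<psi> a)"]) auto
qed

lemma radius_convexity_classRH0: "radius_convexity (harm ` classRH0) = sqrt 2 - 1"
proof -
  have s: "0 < sqrt 2 - 1" "sqrt 2 < 2" by (simp, rule real_less_lsqrt) auto
  have "inj_on (harm p) (ball 0 (sqrt 2 - 1)) \<and> convex (harm p ` ball 0 (sqrt 2 - 1))" if "p \<in> classRH0" for p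
    using classRH0_close_to_convex(1)[of "fst p" "snd p" 1 "sqrt 2 - 1"]
      classRH0_convex_image[of "fst p" "snd p" "sqrt 2 - 1"] that s
    by (simp add: harm_eq[of "fst p" "snd p", simplified])
  moreover have "x \<le> sqrt 2 - 1" if "x \<le> 1" "convex (harm f0 ` ball 0 x)" for x
    using f0_image_nonconvex[of x] that by (meson not_le)
  ultimately show ?thesis
    unfolding radius_convexity_def using s f0_in_classRH0 by (intro cSup_eq_maximum) auto
qed

section \<open>Convolutions\<close>

text \<open>With \<open>cmod z < s < 1\<close>, write \<open>z ^ n = (z / s) ^ n * s ^ n\<close>:
  the terms of \<open>f\<close> at \<open>z / s\<close> are absolutely summable and those of
  \<open>\<phi>\<close> at \<open>s\<close> are bounded.\<close>

lemma hadamard_sums: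
  assumes f: "f holomorphic_on ball 0 1" and \<phi>: "\<phi> holomorphic_on ball 0 1" and z: "z \<in> ball 0 1"
  shows "(\<lambda>n. coef f n * coef \<phi> n * z ^ n) sums hadamard f \<phi> z"
proof -
  obtain s where s: "cmod z < s" "s < 1" using z dense by auto
  then have s0: "0 < s" by (meson norm_ge_zero le_less_trans)
  have "cmod z / s < 1" using s s0 by simp
  then obtain t where t: "cmod z / s < t" "t < 1" using dense by blast
  have "0 \<le> cmod z / s" using s0 by simp
  then have t0: "0 < t" using t(1) by linarith
  have "summable (\<lambda>n. coef f n * of_real t ^ n)"
    by (rule sums_summable[OF holomorphic_sums_coef[OF f]]) (use t0 t in simp)
  then have sf: "summable (\<lambda>n. norm (coef f n * (z / of_real s) ^ n))"
    by (rule powser_insidea) (use t t0 s0 in \<open>simp add: norm_divide\<close>)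
  have "summable (\<lambda>n. coef \<phi> n * of_real s ^ n)"
    by (rule sums_summable[OF holomorphic_sums_coef[OF \<phi>]]) (use s0 s in simp)
  then have "Bseq (\<lambda>n. coef \<phi> n * of_real s ^ n)"
    using summable_LIMSEQ_zero convergentI convergent_imp_Bseq by blast
  then obtain K where K: "\<And>n. norm (coef \<phi> n * of_real s ^ n) \<le> K" by (auto simp: Bseq_def)
  have "summable (\<lambda>n. coef f n * coef \<phi> n * z ^ n)"
  proof (rule summable_comparison_test')
    show "summable (\<lambda>n. norm (coef f n * (z / of_real s) ^ n) * K)" using sf by (rule summable_mult2)
    fix n :: nat
    have "coef f n * coef \<phi> n * z ^ n = (coef f n * (z / of_real s) ^ n) * (coef \<phi> n * of_real s ^ n)"
      using s0 by (simp add: power_divide)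
    then show "norm (coef f n * coef \<phi> n * z ^ n) \<le> norm (coef f n * (z / of_real s) ^ n) * K"
      by (simp only: norm_mult[of "coef f n * (z / of_real s) ^ n"]) (intro mult_left_mono K norm_ge_zero)
  qed
  then show ?thesis unfolding hadamard_def by (rule summable_sums)
qed

lemma holomorphic_hadamard:
  assumes "f holomorphic_on ball 0 1" "\<phi> holomorphic_on ball 0 1"
  shows "hadamard f \<phi> holomorphic_on ball 0 1"
  using hadamard_sums[OF assms] by (intro power_series_holomorphic) auto

lemma coef_hadamard:
  assumes "f holomorphic_on ball 0 1" "\<phi> holomorphic_on ball 0 1"
  shows "coef (hadamard f \<phi>) n = coef f n * coef \<phi> n"
  using hadamard_sums[OF assms] by (intro coef_unique[of 1]) auto

text \<open>With \<open>R = 2 * Q - 1\<close>, partial sums of the Hadamard product are, up to a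
  factor, means of partial sums of \<open>P\<close> against the positive weights
  \<open>Re R\<close>. The mean of values in the right half plane stays there.\<close>

lemma hadamard_Re_pos:
  assumes P: "P holomorphic_on ball 0 1" "P 0 = 1" "\<And>z. z \<in> ball 0 1 \<Longrightarrow> 0 < Re (P z)"
    and Q: "Q holomorphic_on ball 0 1" "Q 0 = 1" "\<And>z. z \<in> ball 0 1 \<Longrightarrow> 1 / 2 \<le> Re (Q z)"
    and z: "z \<in> ball 0 1"
  shows "0 < Re (hadamard P Q z)"
proof (rule Re_pos_if_Re_nonneg[of "hadamard P Q" "ball 0 1" 0])
  show "hadamard P Q holomorphic_on ball 0 1" by (rule holomorphic_hadamard) fact+
  have "hadamard P Q 0 = coef P 0 * coef Q 0"
    using coef_hadamard[OF P(1) Q(1), of 0] by (simp add: coef_0)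
  then show "0 < Re (hadamard P Q 0)" using P(2) Q(2) by (simp add: coef_0)
  define R where "R = (\<lambda>z. 2 * Q z - 1)"
  have R: "R holomorphic_on ball 0 1" unfolding R_def by (intro holomorphic_intros Q)
  have Rpos: "0 < Re (R z)" if "z \<in> ball 0 1" for z
  proof (rule Re_pos_if_Re_nonneg[OF R _ _ _ _ _ that, of 0])
    show "0 \<le> Re (R x)" if "x \<in> ball 0 1" for x using Q(3)[OF that] by (simp add: R_def)
  qed (use Q(2) in \<open>simp_all add: R_def\<close>)
  have coefR: "coef R n = 2 * coef Q n - (if n = 0 then 1 else 0)" for n
  proof (rule coef_unique[of 1])
    fix z :: complex assume z: "z \<in> ball 0 1"
    have "(\<lambda>n. 2 * (coef Q n * z ^ n) - (if n = 0 then 1 else 0)) sums (2 * Q z - 1)"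
      by (intro sums_diff sums_mult holomorphic_sums_coef[OF Q(1) z] sums_single[of 0 "\<lambda>_. 1"])
    moreover have "(\<lambda>n. 2 * (coef Q n * z ^ n) - (if n = 0 then 1 else 0))
       = (\<lambda>n. (2 * coef Q n - (if n = 0 then 1 else 0)) * z ^ n)"
      by (auto simp: algebra_simps)
    ultimately show "(\<lambda>n. (2 * coef Q n - (if n = 0 then 1 else 0)) * z ^ n) sums R z"
      by (simp add: R_def)
  qed simp
  fix z :: complex assume z: "z \<in> ball 0 1"
  obtain s where s: "cmod z < s" "s < 1" using z dense by auto
  then have s0: "0 < s" by (meson norm_ge_zero le_less_trans)
  \<comment> \<open>Factoring \<open>z = w * s\<close> puts the points used for \<open>P\<close> and
    for \<open>R\<close> into compact subdisks on which partial sums are eventually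
    positive.\<close>
  define w where "w = z / of_real s"
  have w: "cmod w < 1" using s s0 by (simp add: w_def norm_divide)
  have step: "0 \<le> Re (\<Sum>j\<le>N. coef P j * coef Q j * z ^ j)"
    if NP: "\<forall>x\<in>cball 0 (cmod w). 0 < Re (\<Sum>i\<le>N. coef P i * x ^ i)"
      and NR: "\<forall>x\<in>cball 0 s. 0 < Re (\<Sum>i\<le>N. coef R i * x ^ i)" for N
  proof -
    define M where "M = Suc (2 * N)"
    define u where "u = (\<lambda>k. cis (2 * pi / real M) ^ k)"
    define a where "a = (\<lambda>i. coef P i * w ^ i)"
    define b where "b = (\<lambda>i. coef R i * of_real s ^ i)"
    have nu: "cmod (u k) = 1" for k by (simp add: u_def norm_power)
    have pos: "0 < Re (\<Sum>i\<le>N. a i * cnj (u k) ^ i)" "0 < 2 * Re (\<Sum>j\<le>N. b j * u k ^ j)" for k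
    proof -
      have "(\<Sum>i\<le>N. a i * cnj (u k) ^ i) = (\<Sum>i\<le>N. coef P i * (w * cnj (u k)) ^ i)"
        "(\<Sum>j\<le>N. b j * u k ^ j) = (\<Sum>j\<le>N. coef R j * (of_real s * u k) ^ j)"
        by (simp_all only: a_def b_def power_mult_distrib mult.assoc)
      moreover have "w * cnj (u k) \<in> cball 0 (cmod w)" "of_real s * u k \<in> cball 0 s"
        using nu[of k] s0 by (simp_all add: norm_mult)
      ultimately show "0 < Re (\<Sum>i\<le>N. a i * cnj (u k) ^ i)" "0 < 2 * Re (\<Sum>j\<le>N. b j * u k ^ j)"
        using NP NR by auto
    qed
    have id: "(\<Sum>k<M. (\<Sum>i\<le>N. a i * cnj (u k) ^ i) * of_real (2 * Re (\<Sum>j\<le>N. b j * u k ^ j)))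
      = of_nat M * ((\<Sum>j\<le>N. a j * b j) + a 0 * cnj (b 0))"
      unfolding u_def by (rule sum_roots_unity_mult_Re) (simp add: M_def)
    have "0 \<le> Re (\<Sum>k<M. (\<Sum>i\<le>N. a i * cnj (u k) ^ i) * of_real (2 * Re (\<Sum>j\<le>N. b j * u k ^ j)))"
      unfolding Re_sum times_complex.sel Im_complex_of_real Re_complex_of_real
      using pos by (intro sum_nonneg) (simp add: less_imp_le)
    then have "0 \<le> real M * Re ((\<Sum>j\<le>N. a j * b j) + a 0 * cnj (b 0))"
      unfolding id by simp
    \<comment> \<open>The extra constant term of the averaging identity equals 1 and compensates for
      the \<open>- 1\<close> in \<open>R\<close>.\<close>
    moreover have "(\<Sum>j\<le>N. a j * b j) + a 0 * cnj (b 0) = 2 * (\<Sum>j\<le>N. coef P j * coef Q j * z ^ j)"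
    proof -
      have "a j * b j = 2 * (coef P j * coef Q j * z ^ j) - (if j = 0 then 1 else 0)" for j
      proof -
        have "a j * b j = coef P j * coef R j * (w * of_real s) ^ j"
          by (simp add: a_def b_def power_mult_distrib)
        also have "w * of_real s = z" using s0 by (simp add: w_def)
        finally show ?thesis using P(2) Q(2) by (cases "j = 0") (simp_all add: coefR coef_0[of P] coef_0[of Q])
      qed
      moreover have "a 0 * cnj (b 0) = 1" using P(2) Q(2) by (simp add: a_def b_def coefR coef_0[of P] coef_0[of Q])
      ultimately show ?thesis
        by (simp add: sum_subtractf sum_distrib_left)
    qed
    ultimately show ?thesis by (simp add: M_def zero_le_mult_iff)
  qed
  have "eventually (\<lambda>N. (\<forall>x\<in>cball 0 (cmod w). 0 < Re (\<Sum>i\<le>N. coef P i * x ^ i)) \<and>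
     (\<forall>x\<in>cball 0 s. 0 < Re (\<Sum>i\<le>N. coef R i * x ^ i))) sequentially"
    using w s0 s(2)
    by (intro eventually_conj eventually_Re_partial_sum_pos[OF P(1) _ _ P(3)] eventually_Re_partial_sum_pos[OF R _ _ Rpos]) auto
  then have ev: "eventually (\<lambda>N. 0 \<le> Re (\<Sum>j\<le>N. coef P j * coef Q j * z ^ j)) sequentially"
    by (rule eventually_mono) (use step in blast)
  have "(\<lambda>N. \<Sum>j\<le>N. coef P j * coef Q j * z ^ j) \<longlonglongrightarrow> hadamard P Q z"
    using hadamard_sums[OF P(1) Q(1) z] by (simp add: sums_def_le)
  then show "0 \<le> Re (hadamard P Q z)"
    by (intro tendsto_lowerbound[OF tendsto_Re ev]) auto
qed (use z in auto)

text \<open>Differentiation shifts the index, so the derivative of \<open>hadamard h \<phi>\<close>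
  is the Hadamard product of \<open>deriv h\<close> with \<open>\<phi> z / z\<close>. The weak
  inequality is assumed because convex \<open>\<phi>\<close> provides only that.\<close>

lemma classRH0_harm_conv:
  assumes \<phi>: "\<phi> \<in> classA" and Re\<phi>: "\<And>z. z \<in> ball 0 1 \<Longrightarrow> z \<noteq> 0 \<Longrightarrow> 1 / 2 \<le> Re (\<phi> z / z)"
    and hg: "(h, g) \<in> classRH0"
  shows "(hadamard h \<phi>, hadamard g \<phi>) \<in> classRH0"
proof -
  note hg' = hg[unfolded classRH0_iff]
  have \<phi>': "\<phi> holomorphic_on ball 0 1" "\<phi> 0 = 0" "deriv \<phi> 0 = 1"
    using \<phi> by (auto simp: classA_def unit_disk_def)
  define q where "q = (\<lambda>z. if z = 0 then deriv \<phi> 0 else (\<phi> z - \<phi> 0) / (z - 0))"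
  have q: "q holomorphic_on ball 0 1"
    unfolding q_def by (rule pole_lemma_open[OF \<phi>'(1) open_ball])
  have qRe: "1 / 2 \<le> Re (q z)" if "z \<in> ball 0 1" for z
    using Re\<phi>[OF that] \<phi>' by (simp add: q_def)
  have coefq: "coef q n = coef \<phi> (Suc n)" for n
  proof (rule coef_unique[of 1])
    fix z :: complex assume z: "z \<in> ball 0 1"
    show "(\<lambda>n. coef \<phi> (Suc n) * z ^ n) sums q z"
    proof (cases "z = 0")
      case True
      have "(\<lambda>n. coef \<phi> (Suc n) * 0 ^ n) sums (coef \<phi> (Suc 0))"
        by (rule powser_sums_zero)
      then show ?thesis using True by (simp add: q_def coef_def)
    next
      case False
      have "(\<lambda>n. coef \<phi> (Suc n) * z ^ Suc n) sums \<phi> z"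
        using holomorphic_sums_coef[OF \<phi>'(1) z] \<phi>'(2) by (subst sums_Suc_iff) (simp add: coef_0)
      from sums_divide[OF this, of z] show ?thesis using False \<phi>'(2) by (simp add: q_def)
    qed
  qed simp
  have H: "hadamard h \<phi> holomorphic_on ball 0 1" "hadamard g \<phi> holomorphic_on ball 0 1"
    using hg' \<phi>' holomorphic_hadamard by auto
  have c1: "coef f (Suc 0) = deriv f 0" for f by (simp add: coef_def)
  have eq: "deriv (hadamard h \<phi>) z + \<epsilon> * deriv (hadamard g \<phi>) z
      = hadamard (\<lambda>z. deriv h z + \<epsilon> * deriv g z) q z" if z: "z \<in> ball 0 1" for z \<epsilon>
  proof -
    let ?P = "\<lambda>z. deriv h z + \<epsilon> * deriv g z"
    have dh: "deriv h holomorphic_on ball 0 1" "deriv g holomorphic_on ball 0 1"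
      using hg' by (auto intro: holomorphic_deriv)
    have "(\<lambda>n. coef (deriv (hadamard h \<phi>)) n * z ^ n + \<epsilon> * (coef (deriv (hadamard g \<phi>)) n * z ^ n))
      sums (deriv (hadamard h \<phi>) z + \<epsilon> * deriv (hadamard g \<phi>) z)"
      using H z by (intro sums_add sums_mult holomorphic_sums_coef[where r = 1] holomorphic_deriv) auto
    moreover have "coef (deriv (hadamard h \<phi>)) n * z ^ n + \<epsilon> * (coef (deriv (hadamard g \<phi>)) n * z ^ n)
      = coef ?P n * coef q n * z ^ n" for n
      using hg' \<phi>' coef_add_cmult[OF dh, of \<epsilon> n]
      by (simp add: coef_deriv coef_hadamard coefq algebra_simps del: of_nat_Suc)
    moreover have "(\<lambda>n. coef ?P n * coef q n * z ^ n) sums hadamard ?P q z"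
      by (intro hadamard_sums q z holomorphic_on_add holomorphic_on_mult holomorphic_on_const dh)
    ultimately show ?thesis using sums_unique2 by (metis (no_types, lifting) ext)
  qed
  have "cmod (deriv (hadamard g \<phi>) z) < Re (deriv (hadamard h \<phi>) z)" if z: "z \<in> ball 0 1" for z
    unfolding Re_pos_rotations_iff[symmetric]
  proof (intro allI impI)
    fix \<epsilon> :: complex assume e: "cmod \<epsilon> = 1"
    show "0 < Re (deriv (hadamard h \<phi>) z + \<epsilon> * deriv (hadamard g \<phi>) z)"
      unfolding eq[OF z]
      by (rule hadamard_Re_pos[OF classRH0_Caratheodory[OF hg e] q _ qRe z]) (use \<phi>' in \<open>auto simp: q_def\<close>)
  qed
  moreover have "hadamard f \<phi> 0 = 0" "deriv (hadamard f \<phi>) 0 = deriv f 0"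
    if "f holomorphic_on ball 0 1" "f 0 = 0" for f
    using coef_hadamard[OF that(1) \<phi>'(1), of 0] coef_hadamard[OF that(1) \<phi>'(1), of "Suc 0"] that(2) \<phi>'(3)
    by (simp_all add: coef_0 c1)
  ultimately show ?thesis unfolding classRH0_iff using H hg' by auto
qed

section \<open>Convex univalent functions\<close>

text \<open>The derivative at \<^term>\<open>t = 0\<close> of the inverse image of \<^term>\<open>(1 - t) * f z + t * f w\<close>, which by
  convexity and the Schwarz lemma stays in the disk of radius \<^term>\<open>cmod z\<close>.\<close>
lemma convex_univalent_inner_le:
  assumes hol: "f holomorphic_on ball 0 1" and inj: "inj_on f (ball 0 1)" and f0: "f 0 = 0"
    and conv: "convex (f ` ball 0 1)" and z: "z \<in> ball 0 1" "z \<noteq> 0" and w: "cmod w \<le> cmod z"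
  shows "Re (cnj z * ((f w - f z) / deriv f z)) \<le> 0"
proof (rule ccontr)
  assume neg: "\<not> ?thesis"
  obtain g where g: "g holomorphic_on f ` ball 0 1"
      "\<And>z. z \<in> ball 0 1 \<Longrightarrow> deriv f z * deriv g (f z) = 1" "\<And>z. z \<in> ball 0 1 \<Longrightarrow> g (f z) = z"
    by (rule holomorphic_has_inverse[OF hol open_ball inj]) auto
  have op: "open (f ` ball 0 1)" by (rule open_mapping_thm3[OF hol open_ball inj])
  define x where "x = w / z"
  have x: "cmod x \<le> 1" "x * z = w" using z w by (auto simp: x_def norm_divide)
  have xb: "x * \<zeta> \<in> ball 0 1" if "\<zeta> \<in> ball 0 1" for \<zeta>
  proof -
    have "cmod x * cmod \<zeta> \<le> 1 * cmod \<zeta>" using x(1) by (intro mult_right_mono) auto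
    then show ?thesis using that by (simp add: norm_mult)
  qed
  have le: "cmod (g ((1 - t) *\<^sub>R f z + t *\<^sub>R f w)) \<le> cmod z" if t: "0 \<le> t" "t \<le> 1" for t
  proof -
    \<comment> \<open>A holomorphic self-map of the disk fixing 0, because both
      \<open>f \<zeta>\<close> and \<open>f (x * \<zeta>)\<close> lie in the convex image. At
      \<open>\<zeta> = z\<close> it is the point to be estimated.\<close>
    define \<omega> where "\<omega> = (\<lambda>\<zeta>. g ((1 - t) *\<^sub>R f \<zeta> + t *\<^sub>R f (x * \<zeta>)))"
    have mem: "(1 - t) *\<^sub>R f \<zeta> + t *\<^sub>R f (x * \<zeta>) \<in> f ` ball 0 1" if "\<zeta> \<in> ball 0 1" for \<zeta>
      using that xb[OF that] t by (intro convexD_alt[OF conv]) auto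
    have "(\<lambda>\<zeta>. f (x * \<zeta>)) holomorphic_on ball 0 1"
      using xb by (intro holomorphic_on_compose_gen[OF _ hol, unfolded o_def] holomorphic_intros) auto
    then have "(\<lambda>\<zeta>. (1 - t) *\<^sub>R f \<zeta> + t *\<^sub>R f (x * \<zeta>)) holomorphic_on ball 0 1"
      unfolding scaleR_conv_of_real by (intro holomorphic_intros hol)
    then have "\<omega> holomorphic_on ball 0 1"
      unfolding \<omega>_def using mem by (intro holomorphic_on_compose_gen[OF _ g(1), unfolded o_def]) auto
    moreover have "\<omega> 0 = 0" using g(3)[of 0] by (simp add: \<omega>_def f0)
    moreover have "cmod (\<omega> \<zeta>) < 1" if "cmod \<zeta> < 1" for \<zeta>
      using mem[of \<zeta>] g(3) that unfolding \<omega>_def by force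
    ultimately have "cmod (\<omega> z) \<le> cmod z" by (rule Schwarz_Lemma(1)) (use z in auto)
    then show ?thesis by (simp add: \<omega>_def x(2))
  qed
  define k where "k = (\<lambda>t. g (f z + of_real t * (f w - f z)))"
  define D where "D = (f w - f z) / deriv f z"
  have "((\<lambda>t. f z + of_real t * (f w - f z)) has_vector_derivative (f w - f z)) (at 0)"
    by (auto intro!: derivative_eq_intros simp: has_vector_derivative_def scaleR_conv_of_real)
  moreover have "(g has_field_derivative deriv g (f z)) (at (f z + of_real 0 * (f w - f z)))"
    using holomorphic_derivI[OF g(1) op] z by simp
  ultimately have "(k has_vector_derivative ((f w - f z) * deriv g (f z))) (at 0)"
    using field_vector_diff_chain_at unfolding k_def o_def by blast
  moreover have "(f w - f z) * deriv g (f z) = D"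
  proof -
    have "deriv f z \<noteq> 0" using g(2)[OF z(1)] by auto
    moreover from this have "deriv g (f z) = 1 / deriv f z"
      using g(2)[OF z(1)] by (simp add: eq_divide_eq mult.commute)
    ultimately show ?thesis by (simp add: D_def)
  qed
  ultimately have dk: "(k has_vector_derivative D) (at 0)" by simp
  \<comment> \<open>The squared modulus of \<open>k\<close>, with derivative
    \<open>2 * Re (cnj z * D)\<close> at 0; were this positive, \<open>k\<close> would leave the
    disk of radius \<open>cmod z\<close>.\<close>
  define m where "m = (\<lambda>t. Re (cnj (k t) * k t))"
  have k0: "k 0 = z" using g(3)[OF z(1)] by (simp add: k_def)
  have "(m has_real_derivative Re (cnj (k 0) * D + cnj D * k 0)) (at 0)"
    unfolding has_real_derivative_iff_has_vector_derivative m_def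
    by (intro bounded_linear.has_vector_derivative[OF bounded_linear_Re] has_vector_derivative_mult
        has_vector_derivative_cnj dk)
  moreover have "Re (cnj (k 0) * D + cnj D * k 0) = 2 * Re (cnj z * D)" by (simp add: k0)
  then have "0 < Re (cnj (k 0) * D + cnj D * k 0)" using neg unfolding D_def[symmetric] by linarith
  ultimately have "\<exists>d>0. \<forall>h>0. h < d \<longrightarrow> m 0 < m (0 + h)" by (rule DERIV_pos_inc_right)
  then obtain d where d: "0 < d" "\<And>t. 0 < t \<Longrightarrow> t < d \<Longrightarrow> m 0 < m (0 + t)" by blast
  define t where "t = min (d / 2) 1"
  have t: "0 < t" "t < d" "t \<le> 1" using d(1) by (auto simp: t_def)
  have sq: "Re (cnj a * a) = (cmod a)\<^sup>2" for a unfolding cmod_power2 by (simp add: power2_eq_square)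
  have "(cmod z)\<^sup>2 < (cmod (k t))\<^sup>2" using d(2)[OF t(1,2)] unfolding m_def sq by (simp add: k0)
  moreover have "k t = g ((1 - t) *\<^sub>R f z + t *\<^sub>R f w)"
    by (simp add: k_def scaleR_conv_of_real algebra_simps)
  then have "(cmod (k t))\<^sup>2 \<le> (cmod z)\<^sup>2" using le[of t] t by (intro power_mono) auto
  ultimately show False by simp
qed

text \<open>The maximum modulus principle for \<open>exp (- k z)\<close>, whose modulus is
  \<open>exp (- Re (k z))\<close>.\<close>

lemma maximum_Re_sphere:
  assumes hol: "k holomorphic_on ball 0 R" and r: "r < R"
    and le: "\<And>z. cmod z = r \<Longrightarrow> c \<le> Re (k z)" and z: "cmod z \<le> r"
  shows "c \<le> Re (k z)"
proof -
  have sub: "cball (0::complex) r \<subseteq> ball 0 R" "ball (0::complex) r \<subseteq> ball 0 R" using r by auto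
  have "cmod (exp (- k z)) \<le> exp (- c)"
  proof (rule maximum_modulus_frontier[of "\<lambda>z. exp (- k z)" "cball 0 r"])
    show "(\<lambda>z. exp (- k z)) holomorphic_on interior (cball 0 r)"
      by (intro holomorphic_intros holomorphic_on_subset[OF hol]) (use sub in auto)
    show "continuous_on (closure (cball 0 r)) (\<lambda>z. exp (- k z))"
      using sub by (intro continuous_intros holomorphic_on_imp_continuous_on holomorphic_on_subset[OF hol]) auto
    show "cmod (exp (- k w)) \<le> exp (- c)" if "w \<in> frontier (cball 0 r)" for w
      using le[of w] that by (simp add: frontier_cball sphere_def)
  qed (use z in auto)
  then show ?thesis by simp
qed

text \<open>The Marx--Strohhaecker inequality. With \<open>S z = deriv f z / (f z - f w) - 1 / (z - w)\<close>, the previous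
  lemma bounds the real part of \<open>z * S z\<close> from below by \<open>-1/2\<close> where \<open>cmod z = cmod w\<close>, so \<open>S z / (1 + z * S z)\<close>
  is bounded by \<open>1 / cmod w\<close> there, hence also at \<open>0\<close>, where its value is \<open>1 / w - 1 / f w\<close>.\<close>
lemma convex_univalent_Re_ge_half:
  assumes hol: "f holomorphic_on ball 0 1" and inj: "inj_on f (ball 0 1)"
    and f0: "f 0 = 0" "deriv f 0 = 1" and conv: "convex (f ` ball 0 1)"
    and w: "w \<in> ball 0 1" "w \<noteq> 0"
  shows "1 / 2 \<le> Re (f w / w)"
proof -
  define r where "r = cmod w"
  have r: "0 < r" "r < 1" using w by (auto simp: r_def)
  have df: "deriv f z \<noteq> 0" if "z \<in> ball 0 1" for z
    using holomorphic_injective_imp_regular[OF hol open_ball inj that] .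
  have fne: "f z \<noteq> f w" if "z \<in> ball 0 1" "z \<noteq> w" for z using inj_onD[OF inj] that w(1) by blast
  \<comment> \<open>Singularities at \<open>w\<close> are removed twice: \<open>q\<close> is
    zero-free by univalence, \<open>E = deriv f / q\<close> takes the value 1 at \<open>w\<close>,
    and its difference quotient \<open>S\<close> is therefore holomorphic.\<close>
  define q where "q = (\<lambda>z. if z = w then deriv f w else (f z - f w) / (z - w))"
  have q: "q holomorphic_on ball 0 1" "\<And>z. z \<in> ball 0 1 \<Longrightarrow> q z \<noteq> 0"
    unfolding q_def using pole_lemma_open[OF hol open_ball] df fne by auto
  define E where "E = (\<lambda>z. deriv f z / q z)"
  have E: "E holomorphic_on ball 0 1"
    unfolding E_def using q hol by (intro holomorphic_intros holomorphic_deriv) auto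
  have Ew: "E w = 1" using df[OF w(1)] by (simp add: E_def q_def)
  define S where "S = (\<lambda>z. if z = w then deriv E w else (E z - E w) / (z - w))"
  have S: "S holomorphic_on ball 0 1" unfolding S_def by (rule pole_lemma_open[OF E open_ball])
  have S_eq: "S z = deriv f z / (f z - f w) - 1 / (z - w)" if "z \<in> ball 0 1" "z \<noteq> w" for z
    using that fne[OF that] df[OF w(1)] by (simp add: S_def Ew E_def q_def field_simps)
  have bd: "- (1 / 2) \<le> Re (z * S z)" if z: "cmod z = r" "z \<noteq> w" for z
  proof -
    have zb: "z \<in> ball 0 1" "z \<noteq> 0" using z r by auto
    have "Re (cnj z * ((f w - f z) / deriv f z)) \<le> 0"
      by (rule convex_univalent_inner_le[OF hol inj f0(1) conv zb]) (simp add: z r_def[symmetric])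
    then have a: "0 \<le> Re (cnj z * ((f z - f w) / deriv f z))"
      by (simp add: diff_divide_distrib algebra_simps)
    define a where "a = (f z - f w) / deriv f z"
    have a0: "a \<noteq> 0" using df[OF zb(1)] fne[OF zb(1) z(2)] by (simp add: a_def)
    have "Re (z / a) = Re (cnj z * a) / (cmod a)\<^sup>2"
      unfolding Re_divide cmod_power2 by simp
    then have 1: "0 \<le> Re (z / a)" using a by (simp add: a_def)
    have "(cmod z)\<^sup>2 = (cmod w)\<^sup>2" using z by (simp add: r_def)
    \<comment> \<open>Equal moduli of \<open>z\<close> and \<open>w\<close> make
      \<open>Re (z / (z - w))\<close> equal to \<open>1 / 2\<close>, the origin of the
      constant.\<close>
    then have "2 * (Re z * (Re z - Re w) + Im z * (Im z - Im w)) = (cmod (z - w))\<^sup>2"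
      unfolding cmod_power2 by (simp add: power2_eq_square algebra_simps)
    moreover have "(cmod (z - w))\<^sup>2 \<noteq> 0" using z(2) by simp
    ultimately have 2: "Re (z / (z - w)) = 1 / 2"
      unfolding Re_divide cmod_power2 by (simp add: field_simps)
    have "z * S z = z / a - z / (z - w)"
      using S_eq[OF zb(1) z(2)] by (simp add: a_def right_diff_distrib)
    then show ?thesis using 1 2 by simp
  qed
  have zS: "(\<lambda>z. z * S z) holomorphic_on ball 0 1" by (intro holomorphic_intros S)
  have bd': "- (1 / 2) \<le> Re (z * S z)" if z: "cmod z = r" for z
  \<comment> \<open>At \<open>w\<close> the bound follows by continuity along the circle.\<close>
  proof (cases "z = w")
    case True
    show ?thesis
    proof (rule tendsto_lowerbound)
      have "((\<lambda>x. w * cis x) \<longlongrightarrow> w * cis 0) (at_right 0)" by (intro tendsto_intros)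
      then have lim: "((\<lambda>x. w * cis x) \<longlongrightarrow> w) (at_right 0)" by simp
      have "isCont (\<lambda>z. z * S z) w"
        using holomorphic_on_imp_continuous_on[OF zS] w(1) continuous_on_eq_continuous_at open_ball by blast
      from tendsto_Re[OF isCont_tendsto_compose[OF this lim]]
      show "((\<lambda>x. Re (w * cis x * S (w * cis x))) \<longlongrightarrow> Re (z * S z)) (at_right 0)" using True by simp
      have "- (1 / 2) \<le> Re (w * cis x * S (w * cis x))" if x: "x \<in> {0<..<1}" for x
      proof (rule bd)
        have "0 < sin x" using x pi_gt3 by (intro sin_gt_zero) auto
        then have "cis x \<noteq> 1" by (auto simp: complex_eq_iff)
        then show "w * cis x \<noteq> w" using w by simp
      qed (simp add: norm_mult r_def)
      then show "\<forall>\<^sub>F x in at_right 0. - (1 / 2) \<le> Re (w * cis x * S (w * cis x))"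
        by (rule eventually_mono[OF eventually_at_right_real[OF zero_less_one]])
    qed simp
  qed (use bd z in auto)
  have inner: "- (1 / 2) \<le> Re (z * S z)" if "cmod z \<le> r" for z
    by (rule maximum_Re_sphere[OF zS r(2) bd' that])
  have sub: "cball (0::complex) r \<subseteq> ball 0 1" "ball (0::complex) r \<subseteq> cball 0 r" using r by auto
  have nz: "1 + z * S z \<noteq> 0" if "cmod z \<le> r" for z
  proof
    assume "1 + z * S z = 0"
    then have "Re (1 + z * S z) = 0" by simp
    then show False using inner[OF that] by simp
  qed
  have "cmod (S 0 / (1 + 0 * S 0)) \<le> 1 / r"
  proof (rule maximum_modulus_frontier[of "\<lambda>z. S z / (1 + z * S z)" "cball 0 r"])
    have B: "(\<lambda>z. S z / (1 + z * S z)) holomorphic_on cball 0 r"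
      using nz by (intro holomorphic_intros holomorphic_on_subset[OF S sub(1)]) auto
    show "(\<lambda>z. S z / (1 + z * S z)) holomorphic_on interior (cball 0 r)"
      using holomorphic_on_subset[OF B sub(2)] by simp
    show "continuous_on (closure (cball 0 r)) (\<lambda>z. S z / (1 + z * S z))"
      using holomorphic_on_imp_continuous_on[OF B] by simp
    fix z assume "z \<in> frontier (cball (0::complex) r)"
    then have z: "cmod z = r" by simp
    \<comment> \<open>For any number \<open>a\<close>, \<open>cmod a \<le> cmod (1 + a)\<close> is
      the half plane \<open>- (1 / 2) \<le> Re a\<close>.\<close>
    have "(cmod (z * S z))\<^sup>2 \<le> (cmod (1 + z * S z))\<^sup>2"
      using bd'[OF z] unfolding cmod_power2 by (simp add: power2_eq_square algebra_simps)
    then have "r * cmod (S z) \<le> cmod (1 + z * S z)"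
      using power2_le_imp_le[of "cmod (z * S z)"] z by (simp add: norm_mult)
    moreover have "0 < cmod (1 + z * S z)" using nz[of z] z by simp
    ultimately show "cmod (S z / (1 + z * S z)) \<le> 1 / r"
      using r by (simp add: norm_divide field_simps)
  qed (use r in auto)
  moreover have "S 0 = 1 / w - 1 / f w"
    using S_eq[of 0] w f0 by (simp add: field_simps)
  ultimately have "cmod (1 / w - 1 / f w) \<le> 1 / cmod w" by (simp add: r_def)
  moreover have fw: "f w \<noteq> 0" using fne[of 0] w f0 by auto
  \<comment> \<open>In terms of \<open>y\<close> the estimate reads
    \<open>cmod (y - 1) \<le> cmod y\<close>, which is the half plane
    \<open>1 / 2 \<le> Re y\<close>.\<close>
  define y where "y = f w / w"
  have y0: "y \<noteq> 0" using fw w by (simp add: y_def)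
  have "1 / w - 1 / f w = (y - 1) / (y * w)"
    using fw w by (simp add: y_def field_simps)
  ultimately have "cmod (y - 1) / (cmod y * cmod w) \<le> 1 / cmod w" by (simp add: norm_divide norm_mult)
  then have "cmod (y - 1) \<le> cmod y" using y0 w by (simp add: field_simps)
  then have "(cmod (y - 1))\<^sup>2 \<le> (cmod y)\<^sup>2" by (intro power_mono) auto
  then show ?thesis unfolding cmod_power2 y_def by (simp add: power2_eq_square algebra_simps)
qed

theorem theorem3p3:
  shows
  \<comment> \<open>harmonic analogue of R, and inclusion in SC_H^0\<close>
  "classRH0 = harm_analogue classR \<and> classRH0 \<subseteq> classSCH0 \<and>
  \<comment> \<open>(i) coefficient bounds, sharp for f_0\<close>
   (\<forall>h g. (h, g) \<in> classRH0 \<longrightarrow>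
      (\<forall>n\<ge>2. \<bar>cmod (coef h n) - cmod (coef g n)\<bar> \<le> 2 / real n)) \<and>
   f0 \<in> classRH0 \<and>
   (\<forall>n\<ge>2. coef (fst f0) n = complex_of_real (2 / real n) \<and> coef (snd f0) n = 0 \<and>
      \<bar>cmod (coef (fst f0) n) - cmod (coef (snd f0) n)\<bar> = 2 / real n) \<and>
  \<comment> \<open>(ii) growth and covering, sharp for f_0\<close>
   (\<forall>p\<in>classRH0. \<forall>z\<in>unit_disk.
      - cmod z + 2 * ln (1 + cmod z) \<le> cmod (harm p z) \<and>
      cmod (harm p z) \<le> - cmod z - 2 * ln (1 - cmod z)) \<and>
   (\<forall>p\<in>classRH0. ball 0 (2 * ln 2 - 1) \<subseteq> harm p ` unit_disk) \<and>
   (\<forall>r::real. 0 \<le> r \<and> r < 1 \<longrightarrow>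
      cmod (harm f0 (complex_of_real r)) = - r - 2 * ln (1 - r) \<and>
      cmod (harm f0 (complex_of_real (- r))) = - r + 2 * ln (1 + r)) \<and>
   complex_of_real (1 - 2 * ln 2) \<notin> harm f0 ` unit_disk \<and>
  \<comment> \<open>(iii) compactness w.r.t. locally uniform convergence\<close>
   (\<forall>(hs::nat \<Rightarrow> complex \<Rightarrow> complex) gs. (\<forall>n. (hs n, gs n) \<in> classRH0) \<longrightarrow>
      (\<exists>r h g. strict_mono r \<and> (h, g) \<in> classRH0 \<and>
         (\<forall>K. compact K \<and> K \<subseteq> unit_disk \<longrightarrow>
            uniform_limit K (\<lambda>n. harm (hs (r n), gs (r n))) (harm (h, g)) sequentially))) \<and>
  \<comment> \<open>(iv) radii\<close>
   radius_convexity (harm ` classRH0) = sqrt 2 - 1 \<and>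
   radius_ctc (harm ` classRH0) = 1 \<and>
  \<comment> \<open>(v) convolution\<close>
   (\<forall>\<phi> p. \<phi> \<in> classK \<and> p \<in> classRH0 \<longrightarrow> harm_conv p \<phi> \<in> classRH0) \<and>
   (\<forall>\<phi> p. \<phi> \<in> classA \<and> (\<forall>z\<in>unit_disk - {0}. Re (\<phi> z / z) > 1 / 2) \<and> p \<in> classRH0
      \<longrightarrow> harm_conv p \<phi> \<in> classRH0) \<and>
  \<comment> \<open>(vi) closure under (finite) convex combinations\<close>
   (\<forall>(N::nat) (t::nat \<Rightarrow> real) hs gs.
      (\<forall>i<N. (hs i, gs i) \<in> classRH0 \<and> t i \<ge> 0) \<and> (\<Sum>i<N. t i) = 1 \<longrightarrow>
      ((\<lambda>z. \<Sum>i<N. complex_of_real (t i) * hs i z),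
       (\<lambda>z. \<Sum>i<N. complex_of_real (t i) * gs i z)) \<in> classRH0)"
proof -
  have f0: "(fst f0, snd f0) \<in> classRH0" using f0_in_classRH0 by simp
  have harm_conv: "harm_conv p \<phi> \<in> classRH0"
    if "\<phi> \<in> classA" "\<And>z. z \<in> ball 0 1 \<Longrightarrow> z \<noteq> 0 \<Longrightarrow> 1 / 2 \<le> Re (\<phi> z / z)" "p \<in> classRH0" for p \<phi>
    using classRH0_harm_conv[OF that(1,2), of "fst p" "snd p"] that(3) by (simp add: harm_conv_def)
  have conv1: "harm_conv p \<phi> \<in> classRH0" if "\<phi> \<in> classK" "p \<in> classRH0" for p \<phi>
  proof (rule harm_conv[OF _ _ that(2)])
    have \<phi>: "\<phi> \<in> classA" "inj_on \<phi> (ball 0 1)" "convex (\<phi> ` ball 0 1)"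
      using that(1) by (auto simp: classK_def classS_def unit_disk_def)
    show "\<phi> \<in> classA" by fact
    show "1 / 2 \<le> Re (\<phi> z / z)" if "z \<in> ball 0 1" "z \<noteq> 0" for z
      using \<phi> that by (intro convex_univalent_Re_ge_half) (auto simp: classA_def unit_disk_def)
  qed
  have conv2: "harm_conv p \<phi> \<in> classRH0"
    if "\<phi> \<in> classA" "\<forall>z\<in>unit_disk - {0}. 1 / 2 < Re (\<phi> z / z)" "p \<in> classRH0" for p \<phi>
    using that by (intro harm_conv) (auto simp: unit_disk_def less_imp_le)
  have growth: "- cmod z + 2 * ln (1 + cmod z) \<le> cmod (harm p z)"
    "cmod (harm p z) \<le> - cmod z - 2 * ln (1 - cmod z)"
    if "p \<in> classRH0" "z \<in> unit_disk" for p z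
    using classRH0_growth[of "fst p" "snd p" z] that by (simp_all add: harm_def unit_disk_def)
  have covering: "ball 0 (2 * ln 2 - 1) \<subseteq> harm p ` unit_disk" if "p \<in> classRH0" for p
    using classRH0_covering[of "fst p" "snd p"] that by (simp add: unit_disk_def)
  have compactness: "\<exists>r h g. strict_mono r \<and> (h, g) \<in> classRH0 \<and>
       (\<forall>K. compact K \<and> K \<subseteq> unit_disk \<longrightarrow>
          uniform_limit K (\<lambda>n. harm (hs (r n), gs (r n))) (harm (h, g)) sequentially)"
    if "\<forall>n. (hs n, gs n) \<in> classRH0" for hs gs :: "nat \<Rightarrow> complex \<Rightarrow> complex"
  proof -
    have hg: "(hs n, gs n) \<in> classRH0" for n using that by blast
    obtain r h g where "strict_mono r" "(h, g) \<in> classRH0"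
      "\<And>K. compact K \<Longrightarrow> K \<subseteq> ball 0 1 \<Longrightarrow> uniform_limit K (\<lambda>n. harm (hs (r n), gs (r n))) (harm (h, g)) sequentially"
      by (rule classRH0_compact[of hs gs, OF hg]) blast
    then show ?thesis unfolding unit_disk_def by blast
  qed
  show ?thesis
  proof (intro conjI allI impI ballI)
    show "classRH0 = harm_analogue classR" by (rule classRH0_eq_harm_analogue)
    show "classRH0 \<subseteq> classSCH0" by (rule classRH0_subset_classSCH0)
    show "\<bar>cmod (coef h n) - cmod (coef g n)\<bar> \<le> 2 / real n" if "(h, g) \<in> classRH0" "2 \<le> n" for h g n
      using that by (rule classRH0_coef_bound)
    show "f0 \<in> classRH0" by (rule f0_in_classRH0)
    show "coef (fst f0) n = complex_of_real (2 / real n)" "coef (snd f0) n = 0"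
      "\<bar>cmod (coef (fst f0) n) - cmod (coef (snd f0) n)\<bar> = 2 / real n" if "2 \<le> n" for n
      unfolding coef_f0[OF that] norm_of_real by simp_all
    show "- cmod z + 2 * ln (1 + cmod z) \<le> cmod (harm p z)"
      "cmod (harm p z) \<le> - cmod z - 2 * ln (1 - cmod z)"
      if "p \<in> classRH0" "z \<in> unit_disk" for p z
      using growth[OF that] by simp_all
    show "ball 0 (2 * ln 2 - 1) \<subseteq> harm p ` unit_disk" if "p \<in> classRH0" for p
      by (rule covering[OF that])
    show "cmod (harm f0 (complex_of_real r)) = - r - 2 * ln (1 - r)"
      "cmod (harm f0 (complex_of_real (- r))) = - r + 2 * ln (1 + r)" if "0 \<le> r \<and> r < 1" for r
      using that by (blast intro: harm_f0_sharp)+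
    show "complex_of_real (1 - 2 * ln 2) \<notin> harm f0 ` unit_disk"
      using f0_omits by (simp add: unit_disk_def)
    show "\<exists>r h g. strict_mono r \<and> (h, g) \<in> classRH0 \<and>
       (\<forall>K. compact K \<and> K \<subseteq> unit_disk \<longrightarrow>
          uniform_limit K (\<lambda>n. harm (hs (r n), gs (r n))) (harm (h, g)) sequentially)"
      if "\<forall>n. (hs n, gs n) \<in> classRH0" for hs gs :: "nat \<Rightarrow> complex \<Rightarrow> complex"
      by (rule compactness[OF that])
    show "radius_convexity (harm ` classRH0) = sqrt 2 - 1" by (rule radius_convexity_classRH0)
    show "radius_ctc (harm ` classRH0) = 1" by (rule radius_ctc_classRH0)
    show "harm_conv p \<phi> \<in> classRH0" if "\<phi> \<in> classK \<and> p \<in> classRH0" for p \<phi>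
      using that conv1 by simp
    show "harm_conv p \<phi> \<in> classRH0"
      if "\<phi> \<in> classA \<and> (\<forall>z\<in>unit_disk - {0}. 1 / 2 < Re (\<phi> z / z)) \<and> p \<in> classRH0" for p \<phi>
      using that conv2[of \<phi> p] by simp
    show "((\<lambda>z. \<Sum>i<N. complex_of_real (t i) * hs i z),
       (\<lambda>z. \<Sum>i<N. complex_of_real (t i) * gs i z)) \<in> classRH0"
      if "(\<forall>i<N. (hs i, gs i) \<in> classRH0 \<and> t i \<ge> 0) \<and> (\<Sum>i<N. t i) = 1"
      for N :: nat and t :: "nat \<Rightarrow> real" and hs gs
      using that by (intro classRH0_convex_combination) auto
  qed
qed

end
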